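(* Let $d\ge 1$ and let $P$ be a $d$-dimensional space-filling zonotope. Then the belt diameter of $P$ is not greater than $\left\lceil \log_2\left(\tfrac45 d\right)\right\rceil$.
   Context: Zonotope: for a finite set of vectors $V=\{\mathbf v_1,\ldots,\mathbf v_n\}\subset\mathbb{R}^d$, $Z(V)=Z(\mathbf v_1,\ldots,\mathbf v_n)$ denotes the Minkowski sum of the segments $[\mathbf 0,\mathbf v_i]$, $i=1,\ldots,n$; polytopes of this form (up to translation) are called zonotopes. A $d$-dimensional polytope in $\mathbb{R}^d$ is a parallelohedron if $\mathbb{R}^d$ can be tiled by its translates. A space-filling zonotope is a zonotope that is a parallelohedron. Belts: let $P$ be a $d$-dimensional polytope with centrally symmetric facets (every zonotope is such a polytope). A facet is a face of dimension $d-1$, a ridge is a (nonempty) face of dimension $d-2$. For a ridge $R$ of $P$, the belt of $P$ corresponding to $R$ is the set of all facets of $P$ parallel to $R$ (i.e. facets whose direction space contains the direction space of $R$). A belt path of length $n$ on $P$ is a sequence $F_0,\mathcal{B}_1,F_1,\mathcal{B}_2,\ldots,\mathcal{B}_n,F_n$ of facets $F_i$ and belts $\mathcal{B}_i$ such that each belt $\mathcal{B}_i$ contains the facets $F_{i-1}$ and $F_i$; it connects $F_0$ and $F_n$. The belt distance $d_{\mathcal B}^P(F,G)$ between facets $F$ and $G$ is the smallest $n$ for which there is a belt path of length $n$ connecting $F$ and $G$, except that the belt distance between two opposite facets (symmetric to each other with respect to the center of $P$) is set to be $0$. The belt diameter of $P$ is the maximal belt distance between two facets of $P$. *)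

theory Defs
  imports "HOL-Analysis.Analysis" "HOL-Library.Set_Algebras" "HOL-Library.Extended_Nat"
begin

text \<open>The sum below is the Minkowski sum of sets from \<open>Set_Algebras\<close>.\<close>

definition zonotope_sum :: "'a::euclidean_space set \<Rightarrow> 'a set" where
  "zonotope_sum V = (\<Sum>v\<in>V. closed_segment 0 v)"

definition zonotope :: "'a::euclidean_space set \<Rightarrow> bool" where
  "zonotope P \<longleftrightarrow> (\<exists>V a. finite V \<and> P = (+) a ` zonotope_sum V)"

text \<open>A tiling is a covering of the whole space by translates with pairwise disjoint interiors;
  it is not required to be face-to-face, and the translation vectors need not form a lattice.\<close>

definition tiles_by_translates :: "'a::euclidean_space set \<Rightarrow> bool" where
  "tiles_by_translates P \<longleftrightarrow>
     (\<exists>T. (\<Union>t\<in>T. (+) t ` P) = UNIV \<and>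
          (\<forall>s\<in>T. \<forall>t\<in>T. s \<noteq> t \<longrightarrow> interior ((+) s ` P) \<inter> interior ((+) t ` P) = {}))"

definition parallelohedron :: "'a::euclidean_space set \<Rightarrow> bool" where
  "parallelohedron P \<longleftrightarrow>
     polytope P \<and> aff_dim P = int (DIM('a)) \<and> tiles_by_translates P"

definition space_filling_zonotope :: "'a::euclidean_space set \<Rightarrow> bool" where
  "space_filling_zonotope P \<longleftrightarrow> zonotope P \<and> parallelohedron P"

definition ridge_of :: "'a::euclidean_space set \<Rightarrow> 'a set \<Rightarrow> bool" (infixr "(ridge'_of)" 50) where
  "R ridge_of P \<longleftrightarrow> R face_of P \<and> R \<noteq> {} \<and> aff_dim R = aff_dim P - 2"

definition direction_space :: "'a::euclidean_space set \<Rightarrow> 'a set" where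
  "direction_space S = span {x - y | x y. x \<in> S \<and> y \<in> S}"

definition belt :: "'a::euclidean_space set \<Rightarrow> 'a set \<Rightarrow> 'a set set" where
  "belt P R = {F. F facet_of P \<and> direction_space R \<subseteq> direction_space F}"

definition belts :: "'a::euclidean_space set \<Rightarrow> 'a set set set" where
  "belts P = {belt P R | R. R ridge_of P}"

text \<open>Only the values \<open>F 0, \<dots>, F n\<close> and \<open>B 1, \<dots>, B n\<close> matter.\<close>

definition belt_path ::
  "'a::euclidean_space set \<Rightarrow> nat \<Rightarrow> (nat \<Rightarrow> 'a set) \<Rightarrow> (nat \<Rightarrow> 'a set set) \<Rightarrow> bool" where
  "belt_path P n F B \<longleftrightarrow>
     (\<forall>i\<in>{0..n}. F i facet_of P) \<and>
     (\<forall>i\<in>{1..n}. B i \<in> belts P \<and> F (i - 1) \<in> B i \<and> F i \<in> B i)"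

definition opposite_facets :: "'a::euclidean_space set \<Rightarrow> 'a set \<Rightarrow> 'a set \<Rightarrow> bool" where
  "opposite_facets P F G \<longleftrightarrow>
     F facet_of P \<and> G facet_of P \<and>
     (\<exists>c. (\<lambda>x. 2 *\<^sub>R c - x) ` P = P \<and> G = (\<lambda>x. 2 *\<^sub>R c - x) ` F)"

text \<open>The distance is \<open>\<infinity>\<close> when no belt path connects the two facets; otherwise the infimum is a
  minimum.\<close>

definition belt_distance :: "'a::euclidean_space set \<Rightarrow> 'a set \<Rightarrow> 'a set \<Rightarrow> enat" where
  "belt_distance P F G =
     (if opposite_facets P F G then 0
      else Inf {enat n | n. \<exists>Fs Bs. belt_path P n Fs Bs \<and> Fs 0 = F \<and> Fs n = G})"

text \<open>A polytope has finitely many facets, so the supremum is a maximum.\<close>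

definition belt_diameter :: "'a::euclidean_space set \<Rightarrow> enat" where
  "belt_diameter P = Sup {belt_distance P F G | F G. F facet_of P \<and> G facet_of P}"

end

theory Submission
  imports Defs
begin

text \<open>
Let \<open>P\<close> be a translate of the zonotope of \<open>V\<close>. The direction spaces of its facets are the hyperplanes
spanned by members of \<open>V\<close>, and the direction spaces of its ridges are the subspaces of dimension
\<open>d - 2\<close> spanned by members of \<open>V\<close>. Since parallel facets are equal or opposite, belt distance becomes a
question on the linear matroid of \<open>V\<close>: how many steps lead from one hyperplane to another, if a step
may go between hyperplanes with a common flat of codimension two
(lemma \<open>belt_distance_le_chain\<close>).

The tiling enters only through the fact that a flat of codimension two lies in at most three of the
hyperplanes, i.e. that belts have at most six facets (theorem \<open>tiling_zonotope_belts_short\<close>). It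
follows from the local picture at a generic point of a ridge, where the tiles form cones in a plane and
each cone contains one of \<open>v\<close>, \<open>- v\<close> for every generator \<open>v\<close>: with four different directions, three such
cones cannot be separated from each other.

Given this, a step from a hyperplane \<open>H1\<close> towards \<open>H2\<close> can be chosen such that the codimension of the
common flat is halved, rounding up (theorem \<open>hyperflat_chain\<close>). For codimension 5, where halving
passes through 3 and 2 to 1, two steps are already enough, because otherwise \<open>V\<close> would contain a
configuration of the Fano type that is incompatible with having three hyperplanes through every flat of
codimension two (lemma \<open>no_fano_pattern\<close>). So \<open>n\<close> steps suffice for codimension up to
\<open>(5 / 4) * 2 ^ n\<close>. The common flat of two hyperplanes has codimension at most \<open>d\<close>, and this gives the
bound.
\<close>

section \<open>Linear algebra modulo a subspace of codimension two\<close>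

text \<open>Finitely many vectors outside \<open>L\<close> never exhaust the choice of a functional vanishing on \<open>L\<close>: if
  \<open>f\<close> already avoids all but one of them, a small multiple of a functional that is nonzero on the
  last one repairs it without spoiling the others.\<close>

lemma finite_generic_orthogonal:
  fixes L V :: "'a::euclidean_space set"
  assumes "finite V" "subspace L"
  obtains f where "\<And>x. x \<in> L \<Longrightarrow> f \<bullet> x = 0" "\<And>v. v \<in> V - L \<Longrightarrow> f \<bullet> v \<noteq> 0"
proof -
  have "\<exists>f. (\<forall>x\<in>L. f \<bullet> x = 0) \<and> (\<forall>v\<in>V-L. f \<bullet> v \<noteq> 0)"
    using assms(1)
  proof (induction V)
    case empty
    show ?case by (intro exI[of _ 0]) auto
  next
    case (insert v V)
    then obtain f where f: "\<forall>x\<in>L. f \<bullet> x = 0" "\<forall>v\<in>V-L. f \<bullet> v \<noteq> 0" by auto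
    show ?case
    proof (cases "v \<in> L \<or> f \<bullet> v \<noteq> 0")
      case True
      then show ?thesis using f by (intro exI[of _ f]) auto
    next
      case False
      obtain y z where yz: "y \<in> span L" "\<And>w. w \<in> span L \<Longrightarrow> orthogonal z w" "v = y + z"
        using orthogonal_subspace_decomp_exists by blast
      have "z \<noteq> 0"
        using yz False \<open>subspace L\<close> by (metis add.right_neutral span_eq_iff)
      moreover have "z \<bullet> v = z \<bullet> z"
        using yz(1) yz(2)[of y] by (simp add: yz(3) inner_add_right orthogonal_def)
      ultimately have zv: "z \<bullet> v \<noteq> 0" by simp
      have zL: "z \<bullet> x = 0" if "x \<in> L" for x
        using yz(2)[of x] that by (simp add: span_base orthogonal_def)
      have "\<forall>\<^sub>F e in at_right (0::real). f \<bullet> w + e * (z \<bullet> w) \<noteq> 0" if "w \<in> V - L" for w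
      proof -
        have "((\<lambda>e. f \<bullet> w + e * (z \<bullet> w)) \<longlongrightarrow> f \<bullet> w + 0 * (z \<bullet> w)) (at_right 0)"
          by (intro tendsto_intros)
        then show ?thesis
          using f(2) that tendsto_imp_eventually_ne by force
      qed
      then have "\<forall>\<^sub>F e in at_right (0::real). \<forall>w\<in>V - L. f \<bullet> w + e * (z \<bullet> w) \<noteq> 0"
        using insert.hyps(1) by (intro eventually_ball_finite) auto
      then have "\<forall>\<^sub>F e in at_right (0::real). e > 0 \<and> (\<forall>w\<in>V - L. f \<bullet> w + e * (z \<bullet> w) \<noteq> 0)"
        using eventually_at_right_less by (rule eventually_conj[rotated])
      then obtain e :: real where e: "e > 0" "\<forall>w\<in>V - L. f \<bullet> w + e * (z \<bullet> w) \<noteq> 0"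
        using eventually_happens'[OF trivial_limit_at_right_real] by blast
      show ?thesis
        using e f zL zv False
        by (intro exI[of _ "f + e *\<^sub>R z"]) (auto simp: inner_add_left)
    qed
  qed
  with that show thesis by blast
qed

lemma orthogonal_to_spanning_set_eq_0:
  fixes g :: "'a::euclidean_space"
  assumes "dim (span S) = DIM('a)" "\<And>x. x \<in> S \<Longrightarrow> g \<bullet> x = 0"
  shows "g = 0"
proof -
  have "span S = UNIV" using assms(1) by (metis dim_eq_full dim_span)
  then have "g \<in> span S" by simp
  moreover have "orthogonal g y" if "y \<in> span S" for y
    by (rule orthogonal_to_span[OF that]) (use assms(2) in \<open>simp add: orthogonal_def\<close>)
  ultimately show ?thesis by (metis orthogonal_self)
qed

text \<open>The quotient by \<open>L\<close> is a plane, and \<open>x\<close>, \<open>y\<close> are a basis of it.\<close>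

lemma functional_zero_mod_codim2:
  fixes L :: "'a::euclidean_space set"
  assumes L: "subspace L" "dim L + 2 = DIM('a)"
    and "x \<notin> L" "y \<notin> span (insert x L)"
    and "\<And>z. z \<in> L \<Longrightarrow> g \<bullet> z = 0" "g \<bullet> x = 0" "g \<bullet> y = 0"
  shows "g = 0"
proof (rule orthogonal_to_spanning_set_eq_0)
  have "span L = L" using L(1) by (simp only: span_eq_iff)
  then have "dim (insert x L) = dim L + 1" "dim (insert y (insert x L)) = dim (insert x L) + 1"
    using assms(3,4) by (simp_all only: dim_insert if_False)
  then show "dim (span (insert y (insert x L))) = DIM('a)"
    using L(2) by simp
qed (use assms in auto)

text \<open>The pair \<open>(P, Q)\<close> serves as coordinates on the quotient by \<open>L\<close>, so a nonzero determinant shows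
  that \<open>x\<close> and \<open>y\<close> are not proportional there.\<close>

lemma not_in_span_insert_if_det:
  fixes P Q :: "'a::real_vector \<Rightarrow> real"
  assumes "linear P" "linear Q" "\<And>z. z \<in> L \<Longrightarrow> P z = 0 \<and> Q z = 0" "P x * Q y \<noteq> P y * Q x"
  shows "y \<notin> span (insert x L)"
proof
  assume "y \<in> span (insert x L)"
  then obtain k where k: "y - k *\<^sub>R x \<in> span L"
    by (auto simp: span_breakdown_eq)
  have "P z = 0" "Q z = 0" if "z \<in> span L" for z
    using linear_eq_0_on_span[OF assms(1) _ that] linear_eq_0_on_span[OF assms(2) _ that] assms(3)
    by auto
  from this[OF k] have "P y = k * P x" "Q y = k * Q x"
    by (simp_all add: linear_diff linear_scale assms(1,2))
  with assms(4) show False by simp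
qed

section \<open>Zonotopes and their faces\<close>

abbreviation zono :: "'a::euclidean_space \<Rightarrow> 'a set \<Rightarrow> 'a set" where
  "zono a V \<equiv> (+) a ` zonotope_sum V"

lemma zono_eq:
  assumes "finite V"
  shows "zono a V = {a + (\<Sum>v\<in>V. l v *\<^sub>R v) | l. \<forall>v\<in>V. 0 \<le> l v \<and> l v \<le> 1}"
proof -
  have "zonotope_sum V = {\<Sum>v\<in>V. l v *\<^sub>R v | l. \<forall>v\<in>V. 0 \<le> l v \<and> l v \<le> 1}" (is "_ = ?R")
  proof
    show "zonotope_sum V \<subseteq> ?R"
    proof
      fix x assume "x \<in> zonotope_sum V"
      then obtain s where s: "x = sum s V" "\<forall>v\<in>V. s v \<in> closed_segment 0 v"
        unfolding zonotope_sum_def set_sum_alt[OF assms] by auto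
      then have "\<forall>v\<in>V. \<exists>u. 0 \<le> u \<and> u \<le> 1 \<and> s v = u *\<^sub>R v"
        by (auto simp: in_segment)
      then obtain l where "\<forall>v\<in>V. 0 \<le> l v \<and> l v \<le> 1 \<and> s v = l v *\<^sub>R v" by metis
      with s(1) show "x \<in> ?R" by (auto intro!: exI[of _ l] sum.cong)
    qed
  next
    show "?R \<subseteq> zonotope_sum V"
    proof
      fix x assume "x \<in> ?R"
      then obtain l where l: "x = (\<Sum>v\<in>V. l v *\<^sub>R v)" "\<forall>v\<in>V. 0 \<le> l v \<and> l v \<le> 1" by auto
      then have "\<forall>v\<in>V. l v *\<^sub>R v \<in> closed_segment 0 v" by (auto simp: in_segment)
      with l(1) show "x \<in> zonotope_sum V"
        unfolding zonotope_sum_def set_sum_alt[OF assms]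
        by (auto intro!: exI[of _ "\<lambda>v. l v *\<^sub>R v"])
    qed
  qed
  then show ?thesis by (auto simp: image_def)
qed

definition max_face :: "'a::euclidean_space \<Rightarrow> 'a set \<Rightarrow> 'a set" where
  "max_face f P = {x \<in> P. \<forall>y\<in>P. f \<bullet> y \<le> f \<bullet> x}"

text \<open>A linear functional is maximised over a Minkowski sum of segments by maximising it over each
  segment separately.\<close>

lemma max_face_zono:
  assumes "finite V"
  shows "max_face f (zono a V) =
    {a + (\<Sum>v\<in>V. l v *\<^sub>R v) | l.
       \<forall>v\<in>V. 0 \<le> l v \<and> l v \<le> 1 \<and> (f \<bullet> v > 0 \<longrightarrow> l v = 1) \<and> (f \<bullet> v < 0 \<longrightarrow> l v = 0)}"
    (is "_ = ?R")
proof
  show "max_face f (zono a V) \<subseteq> ?R"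
  proof
    fix x assume x: "x \<in> max_face f (zono a V)"
    then obtain l where l: "x = a + (\<Sum>v\<in>V. l v *\<^sub>R v)" "\<forall>v\<in>V. 0 \<le> l v \<and> l v \<le> 1"
      by (auto simp: max_face_def zono_eq[OF assms])
    define m where "m = (\<lambda>v. if f \<bullet> v > 0 then 1 else (0::real))"
    have "a + (\<Sum>v\<in>V. m v *\<^sub>R v) \<in> zono a V"
      unfolding zono_eq[OF assms] m_def by auto
    then have "f \<bullet> (a + (\<Sum>v\<in>V. m v *\<^sub>R v)) \<le> f \<bullet> x"
      using x by (auto simp: max_face_def)
    then have le: "(\<Sum>v\<in>V. (m v - l v) * (f \<bullet> v)) \<le> 0"
      by (simp add: l(1) inner_add_right inner_sum_right algebra_simps sum_subtractf)
    have nn: "(m v - l v) * (f \<bullet> v) \<ge> 0" if "v \<in> V" for v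
      using l(2) that
      by (cases "f \<bullet> v > 0") (simp_all add: m_def mult_nonneg_nonpos)
    have "(m v - l v) * (f \<bullet> v) = 0" if "v \<in> V" for v
      using le nn sum_nonneg_eq_0_iff[OF assms, of "\<lambda>v. (m v - l v) * (f \<bullet> v)"] sum_nonneg[of V]
        that by (metis (no_types, lifting) order_antisym)
    then have "\<forall>v\<in>V. (f \<bullet> v > 0 \<longrightarrow> l v = 1) \<and> (f \<bullet> v < 0 \<longrightarrow> l v = 0)"
      by (force simp: m_def split: if_splits)
    with l show "x \<in> ?R" by blast
  qed
next
  show "?R \<subseteq> max_face f (zono a V)"
  proof
    fix x assume "x \<in> ?R"
    then obtain l where l: "x = a + (\<Sum>v\<in>V. l v *\<^sub>R v)" "\<forall>v\<in>V. 0 \<le> l v \<and> l v \<le> 1 \<and>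
        (f \<bullet> v > 0 \<longrightarrow> l v = 1) \<and> (f \<bullet> v < 0 \<longrightarrow> l v = 0)" by blast
    have "f \<bullet> y \<le> f \<bullet> x" if y: "y \<in> zono a V" for y
    proof -
      obtain m where m: "y = a + (\<Sum>v\<in>V. m v *\<^sub>R v)" "\<forall>v\<in>V. 0 \<le> m v \<and> m v \<le> 1"
        using y unfolding zono_eq[OF assms] by blast
      have "m v * (f \<bullet> v) \<le> l v * (f \<bullet> v)" if "v \<in> V" for v
      proof (cases "f \<bullet> v" "0::real" rule: linorder_cases)
        case less
        then show ?thesis using l(2) m(2) that by (simp add: mult_nonneg_nonpos)
      next
        case greater
        then show ?thesis using l(2) m(2) that by simp
      qed simp
      then have "(\<Sum>v\<in>V. m v * (f \<bullet> v)) \<le> (\<Sum>v\<in>V. l v * (f \<bullet> v))" by (intro sum_mono)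
      then show ?thesis by (simp add: l m inner_add_right inner_sum_right)
    qed
    moreover have "x \<in> zono a V"
      using l by (auto simp: zono_eq[OF assms])
    ultimately show "x \<in> max_face f (zono a V)" by (auto simp: max_face_def)
  qed
qed

lemma max_face_zono_nonempty:
  assumes "finite V"
  shows "max_face f (zono a V) \<noteq> {}"
  unfolding max_face_zono[OF assms]
  by (auto intro!: exI[of _ "\<lambda>v. if f \<bullet> v > 0 then 1 else 0"])

text \<open>A generator orthogonal to \<open>f\<close> is the only kind that still moves freely in the face of \<open>f\<close>.\<close>

lemma direction_space_max_face:
  assumes "finite V"
  shows "direction_space (max_face f (zono a V)) = span {v \<in> V. f \<bullet> v = 0}"
    (is "_ = span ?V0")
proof
  have "x - y \<in> span ?V0" if xy: "x \<in> max_face f (zono a V)" "y \<in> max_face f (zono a V)" for x y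
  proof -
    obtain l where l: "x = a + (\<Sum>v\<in>V. l v *\<^sub>R v)" "\<forall>v\<in>V. (f \<bullet> v > 0 \<longrightarrow> l v = 1) \<and> (f \<bullet> v < 0 \<longrightarrow> l v = 0)"
      using xy(1) by (auto simp: max_face_zono[OF assms])
    obtain m where m: "y = a + (\<Sum>v\<in>V. m v *\<^sub>R v)" "\<forall>v\<in>V. (f \<bullet> v > 0 \<longrightarrow> m v = 1) \<and> (f \<bullet> v < 0 \<longrightarrow> m v = 0)"
      using xy(2) by (auto simp: max_face_zono[OF assms])
    have "x - y = (\<Sum>v\<in>V. (l v - m v) *\<^sub>R v)"
      by (simp add: l m sum_subtractf scaleR_diff_left)
    also have "\<dots> = (\<Sum>v\<in>?V0. (l v - m v) *\<^sub>R v)"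
    proof (rule sum.mono_neutral_right[OF assms])
      show "\<forall>v\<in>V - ?V0. (l v - m v) *\<^sub>R v = 0"
        using l(2) m(2) by (metis (mono_tags, lifting) DiffE diff_self linorder_neqE_linordered_idom mem_Collect_eq scaleR_eq_0_iff)
    qed auto
    also have "\<dots> \<in> span ?V0" by (intro span_sum span_scale span_base)
    finally show ?thesis .
  qed
  then show "direction_space (max_face f (zono a V)) \<subseteq> span ?V0"
    unfolding direction_space_def by (intro span_minimal) auto
next
  have "v \<in> direction_space (max_face f (zono a V))" if v: "v \<in> ?V0" for v
  proof -
    define l where "l = (\<lambda>v. if f \<bullet> v > 0 then 1 else (0::real))"
    have 1: "a + (\<Sum>w\<in>V. l w *\<^sub>R w) \<in> max_face f (zono a V)"
      unfolding max_face_zono[OF assms] by (auto simp: l_def)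
    have 2: "a + (\<Sum>w\<in>V. (l(v := 1)) w *\<^sub>R w) \<in> max_face f (zono a V)"
      unfolding max_face_zono[OF assms] using v
      by (intro CollectI exI[of _ "l(v := 1)"]) (auto simp: l_def)
    have "(\<Sum>w\<in>V. (l(v := 1)) w *\<^sub>R w) = v + (\<Sum>w\<in>V. l w *\<^sub>R w)"
      using v assms by (simp add: sum.remove[of V v] l_def)
    then have "v = (a + (\<Sum>w\<in>V. (l(v := 1)) w *\<^sub>R w)) - (a + (\<Sum>w\<in>V. l w *\<^sub>R w))"
      by simp
    with 1 2 show ?thesis
      unfolding direction_space_def by (intro span_base) blast
  qed
  then show "span ?V0 \<subseteq> direction_space (max_face f (zono a V))"
    by (intro span_minimal) (auto simp: direction_space_def)
qed

lemma affine_hull_direction_space: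
  assumes "x \<in> S"
  shows "affine hull S = (+) x ` direction_space S"
proof -
  have 1: "affine hull S = (+) x ` span ((\<lambda>y. - x + y) ` S)"
  proof -
    have "affine hull S = affine hull (insert x S)" using assms by (simp add: insert_absorb)
    then show ?thesis
      using affine_hull_insert_span_gen[of x S] assms by (auto simp: insert_absorb image_def)
  qed
  have "span ((\<lambda>y. - x + y) ` S) = direction_space S"
  proof
    show "span ((\<lambda>y. - x + y) ` S) \<subseteq> direction_space S"
      unfolding direction_space_def using assms by (intro span_mono) force
    have "y - z \<in> span ((\<lambda>y. - x + y) ` S)" if "y \<in> S" "z \<in> S" for y z
    proof -
      have "(- x + y) - (- x + z) \<in> span ((\<lambda>y. - x + y) ` S)"
        using that by (intro span_diff span_base) auto
      then show ?thesis by simp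
    qed
    then show "direction_space S \<subseteq> span ((\<lambda>y. - x + y) ` S)"
      unfolding direction_space_def by (intro span_minimal) auto
  qed
  with 1 show ?thesis by simp
qed

lemma aff_dim_direction_space:
  assumes "S \<noteq> {}"
  shows "aff_dim S = int (dim (direction_space S))"
proof -
  obtain x where "x \<in> S" using assms by blast
  then have "aff_dim S = aff_dim ((+) x ` direction_space S)"
    by (metis aff_dim_affine_hull affine_hull_direction_space)
  also have "\<dots> = int (dim (direction_space S))"
    by (simp add: aff_dim_translation_eq aff_dim_subspace direction_space_def)
  finally show ?thesis .
qed

lemma max_face_face_of:
  assumes "convex P"
  shows "max_face f P face_of P"
proof (cases "max_face f P = {}")
  case False
  then obtain x where x: "x \<in> max_face f P" by blast
  then have "max_face f P = P \<inter> {y. f \<bullet> y = f \<bullet> x}"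
    by (force simp: max_face_def)
  moreover have "(P \<inter> {y. f \<bullet> y = f \<bullet> x}) face_of P"
    using x by (intro face_of_Int_supporting_hyperplane_le[OF assms]) (auto simp: max_face_def)
  ultimately show ?thesis by simp
qed simp

section \<open>Tilings near a generic point of a ridge\<close>

text \<open>For a convex set this is the cone of its feasible directions at \<open>x\<close>. Near a point of a polytope it
  determines the polytope, so the tiles at \<open>x\<close> give a subdivision of space into such cones.\<close>

definition feasible_directions :: "'a::euclidean_space set \<Rightarrow> 'a \<Rightarrow> 'a set" where
  "feasible_directions K x = {q. \<exists>e>0. x + e *\<^sub>R q \<in> K}"

lemma feasible_directions_bound:
  assumes "\<And>y. y \<in> K \<Longrightarrow> g \<bullet> y \<le> g \<bullet> x" "q \<in> feasible_directions K x"
  shows "g \<bullet> q \<le> 0"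
proof -
  obtain e where e: "e > 0" "x + e *\<^sub>R q \<in> K"
    using assms(2) by (auto simp: feasible_directions_def)
  have "e * (g \<bullet> q) \<le> 0" using assms(1)[OF e(2)] by (simp add: inner_add_right)
  with e(1) show ?thesis by (simp add: mult_le_0_iff)
qed

text \<open>The coefficient of \<open>v\<close> in a representation of \<open>x\<close> can be raised unless it is 1, and lowered
  unless it is 0. So every tile at a point has one of the two directions feasible, wherever in the
  tile the point lies.\<close>

lemma generator_feasible:
  assumes "finite V" "v \<in> V" "x \<in> zono a V"
  shows "v \<in> feasible_directions (zono a V) x \<or> - v \<in> feasible_directions (zono a V) x"
proof -
  obtain l where l: "x = a + (\<Sum>w\<in>V. l w *\<^sub>R w)" "\<forall>w\<in>V. 0 \<le> l w \<and> l w \<le> 1"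
    using assms(3) unfolding zono_eq[OF assms(1)] by blast
  have move: "x + s *\<^sub>R v \<in> zono a V" if "0 \<le> l v + s" "l v + s \<le> 1" for s
  proof -
    have "x + s *\<^sub>R v = a + (\<Sum>w\<in>V. (l(v := l v + s)) w *\<^sub>R w)"
      using assms(1,2) by (simp add: l(1) sum.remove[of V v] scaleR_add_left)
    moreover have "\<forall>w\<in>V. 0 \<le> (l(v := l v + s)) w \<and> (l(v := l v + s)) w \<le> 1"
      using l(2) that by simp
    ultimately show ?thesis unfolding zono_eq[OF assms(1)] by blast
  qed
  show ?thesis
  proof (cases "l v < 1")
    case True
    then have "x + (1 - l v) *\<^sub>R v \<in> zono a V"
      using l(2) assms(2) by (intro move) auto
    with True show ?thesis unfolding feasible_directions_def by (intro disjI1 CollectI exI[of _ "1 - l v"]) auto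
  next
    case False
    then have "x + (- l v) *\<^sub>R v \<in> zono a V"
      using l(2) assms(2) by (intro move) auto
    then have "x + l v *\<^sub>R (- v) \<in> zono a V" by simp
    with False show ?thesis unfolding feasible_directions_def by (intro disjI2 CollectI exI[of _ "l v"]) auto
  qed
qed

text \<open>Any closed set that does not contain an open set can be cut away from it, one set at a time.\<close>

lemma open_dichotomy_closed_family:
  assumes "finite \<K>" "\<And>K. K \<in> \<K> \<Longrightarrow> closed K" "openin (top_of_set X) U" "U \<noteq> {}"
  obtains U' where "openin (top_of_set X) U'" "U' \<noteq> {}" "U' \<subseteq> U"
    "\<And>K. K \<in> \<K> \<Longrightarrow> U' \<subseteq> K \<or> U' \<inter> K = {}"
proof -
  have "\<exists>U'. openin (top_of_set X) U' \<and> U' \<noteq> {} \<and> U' \<subseteq> U \<and> (\<forall>K\<in>\<K>. U' \<subseteq> K \<or> U' \<inter> K = {})"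
    using assms(1,2)
  proof (induction \<K>)
    case empty
    then show ?case using assms(3,4) by blast
  next
    case (insert K \<K>)
    then obtain U' where U': "openin (top_of_set X) U'" "U' \<noteq> {}" "U' \<subseteq> U"
      "\<forall>K\<in>\<K>. U' \<subseteq> K \<or> U' \<inter> K = {}" by auto
    show ?case
    proof (cases "U' \<subseteq> K")
      case True
      with U' show ?thesis by (intro exI[of _ U']) auto
    next
      case False
      have "openin (top_of_set X) (U' - K)"
        unfolding Diff_eq using U'(1) insert.prems by (intro openin_Int_open) auto
      with U' False show ?thesis by (intro exI[of _ "U' - K"]) auto
    qed
  qed
  then show thesis by (elim exE conjE) (rule that, auto)
qed

locale convex_tiling =
  fixes P T :: "'a::euclidean_space set"
  assumes compact: "compact P" and convex: "convex P" and int: "interior P \<noteq> {}"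
    and cover: "(\<Union>t\<in>T. (+) t ` P) = UNIV"
    and disj: "\<And>s t. \<lbrakk>s \<in> T; t \<in> T; s \<noteq> t\<rbrakk> \<Longrightarrow> interior ((+) s ` P) \<inter> interior ((+) t ` P) = {}"
begin

text \<open>The translation vectors are separated by the inradius of \<open>P\<close>, so a bounded region meets only
  finitely many tiles.\<close>

lemma locally_finite:
  assumes "bounded B"
  shows "finite {t \<in> T. (+) t ` P \<inter> B \<noteq> {}}" (is "finite ?N")
proof (rule ccontr)
  assume inf: "infinite ?N"
  obtain p r where pr: "r > 0" "ball p r \<subseteq> P"
    using int by (metis ex_in_conv mem_interior)
  obtain b where b: "\<And>y. y \<in> B \<Longrightarrow> norm y \<le> b"
    using assms by (auto simp: bounded_iff)
  obtain c where c: "\<And>y. y \<in> P \<Longrightarrow> norm y \<le> c"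
    using compact_imp_bounded[OF compact] by (auto simp: bounded_iff)
  have "norm t \<le> b + c" if "t \<in> ?N" for t
  proof -
    obtain y where "y \<in> P" "t + y \<in> B" using \<open>t \<in> ?N\<close> by auto
    then show ?thesis
      using b[of "t + y"] c[of y] norm_triangle_ineq4[of "t + y" y] by simp
  qed
  then have "bounded ?N" by (intro boundedI[where B = "b + c"])
  then have "compact (closure ?N)" by (simp add: compact_closure)
  then obtain x where x: "x islimpt ?N"
    using Heine_Borel_imp_Bolzano_Weierstrass[OF _ inf closure_subset] by blast
  \<comment> \<open>Two translation vectors closer than the inradius give overlapping interiors.\<close>
  have sep: "dist s t \<ge> r" if "s \<in> T" "t \<in> T" "s \<noteq> t" for s t
  proof (rule ccontr)
    assume "\<not> r \<le> dist s t"
    have ball: "ball (u + p) r \<subseteq> interior ((+) u ` P)" for u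
      using pr(2) by (intro interior_maximal) (metis ball_translation image_mono, simp)
    have "t + p \<in> ball (s + p) r" "t + p \<in> ball (t + p) r"
      using \<open>\<not> r \<le> dist s t\<close> pr(1) by auto
    then show False using ball disj[OF that] by blast
  qed
  obtain s where s: "s \<in> ?N" "s \<noteq> x" "dist s x < r / 2"
    using x[unfolded islimpt_approachable, rule_format, of "r / 2"] pr(1) by auto
  obtain t where t: "t \<in> ?N" "t \<noteq> x" "dist t x < min (r / 2) (dist s x)"
    using x[unfolded islimpt_approachable, rule_format, of "min (r / 2) (dist s x)"] pr(1) s(2)
    by auto
  have "s \<noteq> t" using t by auto
  then show False
    using sep[of s t] s t dist_triangle_half_l[of s x r t] by (auto simp: dist_commute)
qed

lemma closed_tile: "closed ((+) t ` P)"
  using compact_imp_closed[OF compact] by (rule closed_translation)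

lemma convex_tile: "convex ((+) t ` P)"
  using convex by (rule convex_translation)

text \<open>The feasible cones of the tiles at \<open>x\<close> cover the space: of the points \<open>x + q / (n + 1)\<close>, infinitely
  many lie in one and the same tile by local finiteness, and this tile then also contains \<open>x\<close>.\<close>

lemma direction_covered:
  obtains t where "t \<in> T" "x \<in> (+) t ` P" "q \<in> feasible_directions ((+) t ` P) x"
proof -
  define y where "y n = x + inverse (real (Suc n)) *\<^sub>R q" for n
  define N where "N = {t \<in> T. (+) t ` P \<inter> cball x (norm q) \<noteq> {}}"
  have y: "y n \<in> cball x (norm q)" for n
    by (simp add: y_def dist_norm divide_simps) (simp add: algebra_simps)
  have "\<forall>n. \<exists>t. t \<in> N \<and> y n \<in> (+) t ` P"
  proof
    fix n
    obtain t where "t \<in> T" "y n \<in> (+) t ` P" using cover by blast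
    then show "\<exists>t. t \<in> N \<and> y n \<in> (+) t ` P" using y[of n] unfolding N_def by blast
  qed
  then obtain \<tau> where \<tau>: "\<And>n. \<tau> n \<in> N" "\<And>n. y n \<in> (+) (\<tau> n) ` P" by metis
  have "finite N" unfolding N_def by (rule locally_finite) simp
  then obtain t where t: "infinite {n. \<tau> n = t}"
    using pigeonhole_infinite[of "UNIV :: nat set" \<tau>] \<tau>(1) finite_subset[of "range \<tau>" N]
    by auto
  have "t \<in> N" using t \<tau>(1) not_finite_existsD by blast
  have "y \<longlonglongrightarrow> x + 0 *\<^sub>R q"
    unfolding y_def by (intro tendsto_intros LIMSEQ_inverse_real_of_nat)
  then have lim: "y \<longlonglongrightarrow> x" by simp
  have x: "x \<in> (+) t ` P"
  proof (rule ccontr)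
    assume "x \<notin> (+) t ` P"
    then have "\<forall>\<^sub>F n in sequentially. y n \<in> - (+) t ` P"
      using lim closed_tile[of t] by (intro topological_tendstoD) auto
    then have "finite {n. y n \<in> (+) t ` P}"
      by (simp add: cofinite_eq_sequentially[symmetric] eventually_cofinite)
    moreover have "{n. \<tau> n = t} \<subseteq> {n. y n \<in> (+) t ` P}"
      using \<tau>(2) by auto
    ultimately show False using t finite_subset by blast
  qed
  obtain n where "\<tau> n = t" using t not_finite_existsD by blast
  then have "q \<in> feasible_directions ((+) t ` P) x"
    using \<tau>(2)[of n] unfolding feasible_directions_def y_def
    by (intro CollectI exI[of _ "inverse (real (Suc n))"]) auto
  with x \<open>t \<in> N\<close> that show thesis by (auto simp: N_def)
qed

text \<open>A hyperplane separating the interiors of two tiles passes through every common point.\<close>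

lemma tiles_separated:
  assumes "s \<in> T" "t \<in> T" "s \<noteq> t" "x \<in> (+) s ` P" "x \<in> (+) t ` P"
  obtains g where "g \<noteq> 0"
    "\<And>q. q \<in> feasible_directions ((+) s ` P) x \<Longrightarrow> g \<bullet> q \<le> 0"
    "\<And>q. q \<in> feasible_directions ((+) t ` P) x \<Longrightarrow> g \<bullet> q \<ge> 0"
proof -
  have ne: "interior ((+) u ` P) \<noteq> {}" for u
    using int by (simp add: interior_translation)
  obtain g b where g: "g \<noteq> 0" "\<forall>y\<in>interior ((+) s ` P). g \<bullet> y \<le> b"
    "\<forall>y\<in>interior ((+) t ` P). g \<bullet> y \<ge> b"
    using separating_hyperplane_sets[OF convex_interior[OF convex_tile] convex_interior[OF convex_tile]
        ne ne disj[OF assms(1-3)]] by blast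
  have cl: "closure (interior ((+) u ` P)) = (+) u ` P" for u
    using convex_closure_interior[OF convex_tile ne] closed_tile by (simp add: closure_closed)
  have s: "(+) s ` P \<subseteq> {y. g \<bullet> y \<le> b}"
    using g(2) closure_minimal[OF _ closed_halfspace_le[where a = g and b = b], of "interior ((+) s ` P)"] cl by auto
  have t: "(+) t ` P \<subseteq> {y. g \<bullet> y \<ge> b}"
    using g(3) closure_minimal[OF _ closed_halfspace_ge[where a = g and b = b], of "interior ((+) t ` P)"] cl by auto
  have gx: "g \<bullet> x = b" using s t assms(4,5) by force
  have "g \<bullet> q \<le> 0" if "q \<in> feasible_directions ((+) s ` P) x" for q
    by (rule feasible_directions_bound[OF _ that]) (use s gx in auto)
  moreover have "(- g) \<bullet> q \<le> 0" if "q \<in> feasible_directions ((+) t ` P) x" for q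
    by (rule feasible_directions_bound[OF _ that]) (use t gx in auto)
  ultimately show thesis using that[of g] g(1) by auto
qed

text \<open>A tile may meet \<open>R\<close> in a set with boundary inside \<open>R\<close>, because the tiling need not be
  face-to-face. Shrinking a relatively open piece of \<open>R\<close> until each tile either contains it or misses
  it avoids all these boundaries, and at a point of such a piece every tile extends along \<open>R\<close>.\<close>

lemma generic_point:
  assumes "R \<noteq> {}" "convex R" "bounded R"
  obtains x where "x \<in> R"
    "\<And>t u. \<lbrakk>t \<in> T; x \<in> (+) t ` P; u \<in> direction_space R\<rbrakk> \<Longrightarrow> u \<in> feasible_directions ((+) t ` P) x"
proof -
  define N where "N = {t \<in> T. (+) t ` P \<inter> R \<noteq> {}}"
  have "finite N" unfolding N_def by (rule locally_finite[OF assms(3)])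
  obtain U where U: "openin (top_of_set (affine hull R)) U" "U \<noteq> {}" "U \<subseteq> rel_interior R"
    "\<And>K. K \<in> (\<lambda>t. (+) t ` P) ` N \<Longrightarrow> U \<subseteq> K \<or> U \<inter> K = {}"
  proof (rule open_dichotomy_closed_family[of "(\<lambda>t. (+) t ` P) ` N" "affine hull R" "rel_interior R"])
    show "rel_interior R \<noteq> {}" using assms(1,2) by (simp add: rel_interior_eq_empty)
  qed (use \<open>finite N\<close> closed_tile in \<open>auto simp: openin_rel_interior\<close>)
  then obtain x where x: "x \<in> U" by blast
  have xR: "x \<in> R" using x U(3) rel_interior_subset by blast
  show thesis
  proof (rule that[OF xR])
    fix t u assume t: "t \<in> T" "x \<in> (+) t ` P" and u: "u \<in> direction_space R"
    have UP: "U \<subseteq> (+) t ` P"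
      using U(4)[of "(+) t ` P"] t x xR by (auto simp: N_def)
    obtain e where e: "e > 0" "ball x e \<inter> affine hull R \<subseteq> U"
      using U(1) x by (metis openin_contains_ball)
    define c where "c = e / (2 * norm u + 2)"
    have pos: "2 * norm u + 2 > 0" using norm_ge_zero[of u] by linarith
    then have c: "c > 0" using e(1) by (simp add: c_def)
    have "e * norm u < e * (2 * norm u + 2)"
      using norm_ge_zero[of u] e(1) by (intro mult_strict_left_mono) linarith+
    then have "c * norm u < e"
      using pos by (simp add: c_def pos_divide_less_eq)
    then have "x + c *\<^sub>R u \<in> ball x e" using c by (simp add: dist_norm)
    moreover have "x + c *\<^sub>R u \<in> affine hull R"
      using u unfolding affine_hull_direction_space[OF xR]
      by (auto simp: direction_space_def intro: span_scale)
    ultimately show "u \<in> feasible_directions ((+) t ` P) x"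
      using e(2) UP c unfolding feasible_directions_def by blast
  qed
qed

end

section \<open>Belts of space-filling zonotopes are short\<close>

text \<open>A flat of the linear matroid of \<open>V\<close>, given as the subspace it spans.\<close>

definition flat :: "'a::euclidean_space set \<Rightarrow> 'a set \<Rightarrow> bool" where
  "flat V L \<longleftrightarrow> span (V \<inter> L) = L"

text \<open>The hyperplanes through \<open>L\<close> that are spanned by members of \<open>V\<close> correspond to the directions of
  \<open>V\<close> in the plane obtained by factoring out \<open>L\<close>. Each such hyperplane carries two opposite facets of
  the zonotope, so three directions mean a belt of at most six facets.\<close>

definition belts_short :: "'a::euclidean_space set \<Rightarrow> bool" where
  "belts_short V \<longleftrightarrow>
     (\<forall>L S. flat V L \<and> dim L + 2 = DIM('a) \<and> S \<subseteq> V - L \<and>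
        pairwise (\<lambda>x y. y \<notin> span (insert x L)) S \<longrightarrow> card S \<le> 3)"

lemma flat_subspace: "flat V L \<Longrightarrow> subspace L"
  unfolding flat_def by (metis subspace_span)

text \<open>Modulo \<open>L\<close> the picture around a generic point \<open>x\<close> of a ridge with direction \<open>L\<close> is a plane divided
  into cones, one for each tile at \<open>x\<close>. Each cone contains \<open>v\<close> or \<open>- v\<close> for every generator \<open>v\<close>. The
  tile \<open>t0\<close> whose ridge was taken has a cone strictly smaller than a half plane, so at least two other
  tiles are needed. Let \<open>f\<close> be the functional maximal on the ridge, and orient the generators of \<open>S\<close> so
  that \<open>f\<close> is positive on them; then \<open>t0\<close> has the negatives of all of them. Cones of different tiles
  cannot share two independent vectors, as they are separated by a nonzero functional. Hence each of
  the two other tiles has at most one negative generator, and at most one positive generator is common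
  to both. Counting gives at most three generators.\<close>

theorem tiling_zonotope_belts_short:
  fixes V :: "'a::euclidean_space set"
  assumes fin: "finite V" and int: "interior (zono a V) \<noteq> {}" and comp: "compact (zono a V)"
    and conv: "convex (zono a V)" and tiles: "tiles_by_translates (zono a V)"
  shows "belts_short V"
  unfolding belts_short_def
proof (intro allI impI, elim conjE)
  fix L S :: "'a set"
  assume flat: "flat V L" and dimL: "dim L + 2 = DIM('a)" and SV: "S \<subseteq> V - L"
    and indep: "pairwise (\<lambda>x y. y \<notin> span (insert x L)) S"
  note subL = flat_subspace[OF flat]
  define P where "P = zono a V"
  obtain T where T: "(\<Union>t\<in>T. (+) t ` P) = UNIV"
    "\<forall>s\<in>T. \<forall>t\<in>T. s \<noteq> t \<longrightarrow> interior ((+) s ` P) \<inter> interior ((+) t ` P) = {}"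
    using tiles unfolding tiles_by_translates_def P_def by blast
  interpret convex_tiling P T
    using T int comp conv by unfold_locales (auto simp: P_def)
  have tile_zono: "(+) t ` P = zono (t + a) V" for t
    by (simp add: P_def image_image add.assoc)
  show "card S \<le> 3"
  proof (cases "S = {}")
    case False
    obtain f where f: "\<And>x. x \<in> L \<Longrightarrow> f \<bullet> x = 0" "\<And>v. v \<in> V - L \<Longrightarrow> f \<bullet> v \<noteq> 0"
      using finite_generic_orthogonal[OF fin subL] by blast
    obtain v0 where v0: "v0 \<in> S" using False by blast
    then have "f \<noteq> 0" using SV f(2)[of v0] by auto
    have "dim (insert f L) \<le> dim L + 1" by (simp add: dim_insert)
    then have "dim (span (insert f L)) < DIM('a)" using dimL by simp
    then obtain k where k: "k \<noteq> 0" "\<And>x. x \<in> span (insert f L) \<Longrightarrow> orthogonal k x"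
      using orthogonal_to_subspace_exists[of "span (insert f L)"] by (auto simp only: span_span dim_span)
    have kf: "k \<bullet> f = 0"
      using k(2)[of f] by (auto simp: orthogonal_def span_base)
    have kL: "k \<bullet> x = 0" if "x \<in> L" for x
      using k(2)[of x] that by (auto simp: orthogonal_def span_base)
    have fL: "f \<notin> L" using f(1)[of f] \<open>f \<noteq> 0\<close> by auto
    have kfL: "k \<notin> span (insert f L)" using k(1) k(2)[of k] by (auto simp: orthogonal_self)
    \<comment> \<open>Both functionals \<open>f \<plusminus> \<delta> k\<close> single out the same ridge as \<open>f\<close>.\<close>
    have "\<forall>\<^sub>F \<delta> in at_right (0::real). \<delta> * \<bar>k \<bullet> v\<bar> < \<bar>f \<bullet> v\<bar>" if "v \<in> V - L" for v
    proof -
      have "((\<lambda>\<delta>. \<delta> * \<bar>k \<bullet> v\<bar>) \<longlongrightarrow> 0 * \<bar>k \<bullet> v\<bar>) (at_right 0)"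
        by (intro tendsto_intros)
      then show ?thesis using f(2)[OF that] by (intro order_tendstoD(2)[where y = 0]) auto
    qed
    then have "\<forall>\<^sub>F \<delta> in at_right (0::real). \<forall>v\<in>V - L. \<delta> * \<bar>k \<bullet> v\<bar> < \<bar>f \<bullet> v\<bar>"
      using fin by (intro eventually_ball_finite) auto
    then have "\<forall>\<^sub>F \<delta> in at_right (0::real). \<delta> > 0 \<and> (\<forall>v\<in>V - L. \<delta> * \<bar>k \<bullet> v\<bar> < \<bar>f \<bullet> v\<bar>)"
      using eventually_at_right_less by (rule eventually_conj[rotated])
    then obtain \<delta> :: real where \<delta>: "\<delta> > 0" "\<And>v. v \<in> V - L \<Longrightarrow> \<delta> * \<bar>k \<bullet> v\<bar> < \<bar>f \<bullet> v\<bar>"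
      using eventually_happens'[OF trivial_limit_at_right_real] by blast
    have V0: "{v \<in> V. f \<bullet> v = 0} = V \<inter> L"
      using f by blast
    have same_face: "max_face f Z \<subseteq> max_face (f + s *\<^sub>R k) Z" if "\<bar>s\<bar> = \<delta>" "Z = zono b V" for s b Z
    proof -
      have "(f + s *\<^sub>R k) \<bullet> v > 0 \<longrightarrow> f \<bullet> v > 0" "(f + s *\<^sub>R k) \<bullet> v < 0 \<longrightarrow> f \<bullet> v < 0"
        if "v \<in> V" for v
      proof -
        have "f \<bullet> v = 0 \<and> k \<bullet> v = 0 \<or> \<bar>s * (k \<bullet> v)\<bar> < \<bar>f \<bullet> v\<bar>"
          using \<delta>(2)[of v] f(1)[of v] kL[of v] \<open>\<bar>s\<bar> = \<delta>\<close> that by (auto simp: abs_mult)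
        then show "(f + s *\<^sub>R k) \<bullet> v > 0 \<longrightarrow> f \<bullet> v > 0" "(f + s *\<^sub>R k) \<bullet> v < 0 \<longrightarrow> f \<bullet> v < 0"
          by (auto simp: inner_add_left)
      qed
      then show ?thesis
        unfolding that(2) max_face_zono[OF fin] by blast
    qed
    obtain t0 where t0: "t0 \<in> T" using T(1) by blast
    define R where "R = max_face f ((+) t0 ` P)"
    have R_ne: "R \<noteq> {}" unfolding R_def tile_zono by (rule max_face_zono_nonempty[OF fin])
    have R_sub: "R \<subseteq> (+) t0 ` P" by (auto simp: R_def max_face_def)
    have "convex R"
      using max_face_face_of[OF convex_tile] unfolding R_def by (rule face_of_imp_convex)
    moreover have "bounded R"
      using R_sub compact_imp_bounded[OF compact_translation[OF compact]] by (rule bounded_subset[rotated])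
    ultimately obtain x where xR: "x \<in> R" and generic: "\<And>t u. \<lbrakk>t \<in> T; x \<in> (+) t ` P; u \<in> direction_space R\<rbrakk>
        \<Longrightarrow> u \<in> feasible_directions ((+) t ` P) x"
      using generic_point[OF R_ne] by blast
    have dirR: "direction_space R = L"
      unfolding R_def tile_zono direction_space_max_face[OF fin] V0 using flat by (simp add: flat_def)
    have x0: "x \<in> (+) t0 ` P" using xR R_sub by blast
    define C where "C t = feasible_directions ((+) t ` P) x" for t
    define near where "near t \<longleftrightarrow> t \<in> T \<and> x \<in> (+) t ` P" for t
    have near0: "near t0" using t0 x0 by (simp add: near_def)
    have C_L: "u \<in> C t" if "near t" "u \<in> L" for t u
      using generic[of t u] that dirR by (simp add: near_def C_def)
    have C_V: "v \<in> C t \<or> - v \<in> C t" if "near t" "v \<in> V" for t v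
      using generator_feasible[OF fin, of v x "t + a"] that by (simp add: near_def C_def tile_zono)
    have C_cover: "\<exists>t. near t \<and> q \<in> C t" for q
      using direction_covered[of x q] by (metis near_def C_def)
    have C_sep: "\<exists>g. g \<noteq> 0 \<and> (\<forall>q\<in>C s. g \<bullet> q \<le> 0) \<and> (\<forall>q\<in>C t. g \<bullet> q \<ge> 0) \<and> (\<forall>q\<in>L. g \<bullet> q = 0)"
      if st: "near s" "near t" "s \<noteq> t" for s t
    proof -
      obtain g where g: "g \<noteq> 0" "\<And>q. q \<in> C s \<Longrightarrow> g \<bullet> q \<le> 0" "\<And>q. q \<in> C t \<Longrightarrow> g \<bullet> q \<ge> 0"
        using tiles_separated[of s t x] st unfolding near_def C_def by blast
      have "g \<bullet> q = 0" if "q \<in> L" for q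
        using g(2)[OF C_L[OF \<open>near s\<close> that]] g(3)[OF C_L[OF \<open>near t\<close> that]] by simp
      with g show ?thesis by blast
    qed
    have C0: "f \<bullet> q + \<delta> * (k \<bullet> q) \<le> 0" "f \<bullet> q - \<delta> * (k \<bullet> q) \<le> 0" if "q \<in> C t0" for q
    proof -
      have "(f + s *\<^sub>R k) \<bullet> q \<le> 0" if "\<bar>s\<bar> = \<delta>" for s
      proof (rule feasible_directions_bound)
        show "q \<in> feasible_directions ((+) t0 ` P) x" using \<open>q \<in> C t0\<close> by (simp add: C_def)
        have "x \<in> max_face (f + s *\<^sub>R k) ((+) t0 ` P)"
          using same_face[OF that tile_zono] xR by (auto simp: R_def)
        then show "(f + s *\<^sub>R k) \<bullet> y \<le> (f + s *\<^sub>R k) \<bullet> x" if "y \<in> (+) t0 ` P" for y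
          using that by (auto simp: max_face_def)
      qed
      from this[of \<delta>] this[of "- \<delta>"] show "f \<bullet> q + \<delta> * (k \<bullet> q) \<le> 0" "f \<bullet> q - \<delta> * (k \<bullet> q) \<le> 0"
        using \<delta>(1) by (auto simp: inner_add_left inner_diff_left)
    qed
    \<comment> \<open>The directions \<open>\<plusminus>k\<close> and \<open>\<plusminus>p\<close> leave the tile \<open>t0\<close>; a single further tile cannot absorb all four.\<close>
    define \<eta> where "\<eta> = \<delta> * (k \<bullet> k) / (2 * (f \<bullet> f))"
    define p where "p = k + \<eta> *\<^sub>R f"
    have kk: "k \<bullet> k > 0" and ff: "f \<bullet> f > 0" using k(1) \<open>f \<noteq> 0\<close> by auto
    have \<eta>: "\<eta> > 0" "\<eta> * (f \<bullet> f) < \<delta> * (k \<bullet> k)"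
      using kk ff \<delta>(1) by (auto simp: \<eta>_def)
    have ip: "f \<bullet> k = 0" "f \<bullet> p = \<eta> * (f \<bullet> f)" "k \<bullet> p = k \<bullet> k"
      using kf by (auto simp: p_def inner_add_right inner_commute)
    have dk: "\<delta> * (k \<bullet> k) > 0" using \<delta>(1) kk by simp
    have out: "k \<notin> C t0" "- k \<notin> C t0" "p \<notin> C t0" "- p \<notin> C t0"
    proof -
      show "k \<notin> C t0" using C0(1)[of k] dk ip by auto
      show "- k \<notin> C t0" using C0(2)[of "- k"] dk ip by auto
      show "p \<notin> C t0" using C0(1)[of p] dk mult_pos_pos[OF \<eta>(1) ff] unfolding ip by linarith
      show "- p \<notin> C t0" using C0(2)[of "- p"] dk \<eta>(2) ip by auto
    qed
    obtain t1 t2 where t12: "near t1" "near t2" "t1 \<noteq> t0" "t2 \<noteq> t0" "t1 \<noteq> t2"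
    proof -
      have "\<exists>t1 t2. near t1 \<and> near t2 \<and> t1 \<noteq> t0 \<and> t2 \<noteq> t0 \<and> t1 \<noteq> t2"
      proof (rule ccontr)
        assume no: "\<not> ?thesis"
        obtain t where t: "near t" "k \<in> C t" using C_cover by blast
        have tt0: "t \<noteq> t0" using t out by auto
        have all: "q \<in> C t" if "q \<notin> C t0" for q
          using C_cover[of q] no t(1) tt0 that by metis
        obtain g where g: "g \<noteq> 0" "\<forall>q\<in>C t0. g \<bullet> q \<le> 0" "\<forall>q\<in>C t. g \<bullet> q \<ge> 0" "\<forall>q\<in>L. g \<bullet> q = 0"
          using C_sep[OF near0 t(1)] tt0 by blast
        have "g \<bullet> k = 0" "g \<bullet> p = 0"
          using g(3) all out by (metis inner_minus_right neg_0_le_iff_le order_antisym)+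
        then have "g \<bullet> f = 0" using \<eta>(1) by (simp add: p_def inner_add_right)
        have "g = 0"
          by (rule functional_zero_mod_codim2[OF subL dimL fL kfL]) (use g(4) \<open>g \<bullet> k = 0\<close> \<open>g \<bullet> f = 0\<close> in auto)
        with g(1) show False ..
      qed
      with that show thesis by blast
    qed
    have no_common: False if st: "near s" "near t" "s \<noteq> t" "v \<in> S" "w \<in> S" "v \<noteq> w"
      "u \<in> {v, - v}" "z \<in> {w, - w}" "u \<in> C s" "u \<in> C t" "z \<in> C s" "z \<in> C t" for s t v w u z
    proof -
      obtain g where g: "g \<noteq> 0" "\<forall>q\<in>C s. g \<bullet> q \<le> 0" "\<forall>q\<in>C t. g \<bullet> q \<ge> 0" "\<forall>q\<in>L. g \<bullet> q = 0"
        using C_sep[OF st(1-3)] by blast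
      have "g \<bullet> u = 0" "g \<bullet> z = 0" using g(2,3) st(9-12) by (auto intro: order_antisym)
      then have vw: "g \<bullet> v = 0" "g \<bullet> w = 0" using st(7,8) by auto
      have "v \<notin> L" "w \<notin> span (insert v L)"
        using SV indep st(4-6) by (auto simp: pairwise_def)
      then have "g = 0"
        by (rule functional_zero_mod_codim2[OF subL dimL]) (use g(4) vw in auto)
      with g(1) show False ..
    qed

    \<comment> \<open>Orient the generators so that \<open>f\<close> is positive; then \<open>t0\<close> has all the negative ones.\<close>
    define \<sigma> where "\<sigma> v = (if f \<bullet> v > 0 then v else - v)" for v
    have \<sigma>: "\<sigma> v \<in> {v, - v}" "- \<sigma> v \<in> {v, - v}" for v by (auto simp: \<sigma>_def)
    have neg0: "- \<sigma> v \<in> C t0" if "v \<in> S" for v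
    proof -
      have v: "v \<in> V - L" using that SV by blast
      have "f \<bullet> \<sigma> v > 0" using f(2)[OF v] by (auto simp: \<sigma>_def)
      then have "\<sigma> v \<notin> C t0" using C0[of "\<sigma> v"] by auto
      then show ?thesis using C_V[OF near0, of v] v by (auto simp: \<sigma>_def split: if_splits)
    qed
    define N where "N t = {v \<in> S. \<sigma> v \<notin> C t}" for t
    have neg: "- \<sigma> v \<in> C t" if "near t" "v \<in> N t" for t v
      using C_V[OF that(1), of v] that(2) SV by (auto simp: N_def \<sigma>_def split: if_splits)
    have finS: "finite S" using SV fin finite_subset by blast
    have N1: "card (N t) \<le> 1" if "near t" "t \<noteq> t0" for t
    proof -
      have "v = w" if "v \<in> N t" "w \<in> N t" for v w
        using no_common[OF near0 \<open>near t\<close> \<open>t \<noteq> t0\<close>[symmetric] _ _ _ \<sigma>(2)[of v] \<sigma>(2)[of w]]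
          neg[OF \<open>near t\<close>] neg0 that by (auto simp: N_def)
      then show ?thesis by (simp add: card_le_Suc0_iff_eq N_def finS)
    qed
    have "card (S - (N t1 \<union> N t2)) \<le> 1"
    proof -
      have "v = w" if "v \<in> S - (N t1 \<union> N t2)" "w \<in> S - (N t1 \<union> N t2)" for v w
        using no_common[OF t12(1,2,5) _ _ _ \<sigma>(1)[of v] \<sigma>(1)[of w]] that by (auto simp: N_def)
      then show ?thesis using finS by (simp add: card_le_Suc0_iff_eq)
    qed
    moreover have "card (N t1 \<union> N t2) \<le> 2"
      using card_Un_le[of "N t1" "N t2"] N1[OF t12(1,3)] N1[OF t12(2,4)] by linarith
    moreover have "card S \<le> card (S - (N t1 \<union> N t2)) + card (N t1 \<union> N t2)"
      by (metis card_Diff_subset_Int diff_card_le_card_Diff finite_Un le_diff_conv finS finite_subset N_def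
        mem_Collect_eq subsetI)
    ultimately show ?thesis by linarith
  qed simp
qed

section \<open>Chains of hyperplanes\<close>

definition hyperflat :: "'a::euclidean_space set \<Rightarrow> 'a set \<Rightarrow> bool" where
  "hyperflat V H \<longleftrightarrow> flat V H \<and> dim H + 1 = DIM('a)"

definition adjacent :: "'a::euclidean_space set \<Rightarrow> 'a set \<Rightarrow> 'a set \<Rightarrow> bool" where
  "adjacent V H H' \<longleftrightarrow> hyperflat V H \<and> hyperflat V H' \<and>
     (\<exists>L. flat V L \<and> dim L + 2 = DIM('a) \<and> L \<subseteq> H \<and> L \<subseteq> H')"

lemma flat_span:
  assumes "C \<subseteq> V"
  shows "flat V (span C)"
  unfolding flat_def
proof
  show "span (V \<inter> span C) \<subseteq> span C" by (intro span_minimal) auto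
  show "span C \<subseteq> span (V \<inter> span C)" using assms by (intro span_mono) (auto intro: span_base)
qed

lemma linear_representation:
  assumes "independent B" "span B = UNIV"
  shows "linear (\<lambda>x. representation B x b)"
  using assms by (intro linearI) (simp_all add: representation_add representation_scale)

lemma in_span_iff_representation:
  assumes B: "independent B" "span B = UNIV" and "C \<subseteq> B"
  shows "x \<in> span C \<longleftrightarrow> (\<forall>b\<in>B - C. representation B x b = 0)"
proof
  assume x: "x \<in> span C"
  show "\<forall>b\<in>B - C. representation B x b = 0"
  proof
    fix b assume b: "b \<in> B - C"
    show "representation B x b = 0"
      by (rule linear_eq_0_on_span[OF linear_representation[OF B] _ x])
        (use b assms in \<open>auto simp: representation_basis\<close>)
  qed
next
  assume 0: "\<forall>b\<in>B - C. representation B x b = 0"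
  have "(\<Sum>b | representation B x b \<noteq> 0. representation B x b *\<^sub>R b) = x"
    using sum_nonzero_representation_eq[OF B(1)] B(2) by simp
  moreover have "b \<in> C" if "representation B x b \<noteq> 0" for b
    using 0 representation_ne_zero[OF that] that by blast
  ultimately show "x \<in> span C"
    by (metis (mono_tags, lifting) mem_Collect_eq span_base span_scale span_sum)
qed

text \<open>Fix a basis \<open>B\<close> and \<open>w0\<close> in it. Among the hyperplanes containing \<open>B - {u, w0}\<close>, the one through
  \<open>w\<close> is determined by the ratio of the coordinates of \<open>w\<close> at \<open>u\<close> and at \<open>w0\<close>.\<close>

definition slope :: "'a::euclidean_space set \<Rightarrow> 'a \<Rightarrow> 'a \<Rightarrow> 'a \<Rightarrow> real" where
  "slope B w0 u w = representation B w u / representation B w w0"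

context
  fixes V B :: "'a::euclidean_space set" and w0 :: 'a
  assumes fin: "finite V" and short: "belts_short V"
    and B: "independent B" "span B = UNIV" and BV: "B \<subseteq> V" and w0: "w0 \<in> B"
begin

lemma card_B: "card B = DIM('a)" "finite B"
  using dim_span_eq_card_independent[OF B(1)] B(2) finite_subset[OF BV fin] by simp_all

text \<open>Different slopes give different hyperplanes through the flat of \<open>B - {u, w0}\<close>, and the hyperplane
  of \<open>B - {w0}\<close>, which contains \<open>u\<close>, has none of the slopes. Only three hyperplanes are available.\<close>

lemma card_slopes_le_2:
  assumes u: "u \<in> B" "u \<noteq> w0" and Y: "Y \<subseteq> V" "\<And>w. w \<in> Y \<Longrightarrow> representation B w w0 \<noteq> 0"
  shows "card (slope B w0 u ` Y) \<le> 2"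
proof -
  let ?P = "\<lambda>x. representation B x u" and ?Q = "\<lambda>x. representation B x w0"
  obtain S where S: "S \<subseteq> Y" "inj_on (slope B w0 u) S" "slope B w0 u ` S = slope B w0 u ` Y"
    using subset_image_inj[of "slope B w0 u ` Y" "slope B w0 u" Y] by (metis order_refl)
  define C where "C = B - {u, w0}"
  have Pu: "?P u = 1" "?Q u = 0" using u w0 B(1) by (auto simp: representation_basis)
  have L0: "?P z = 0 \<and> ?Q z = 0" if "z \<in> span C" for z
    using in_span_iff_representation[OF B, of C z] that u w0 by (auto simp: C_def)
  have det: "?P x * ?Q y \<noteq> ?P y * ?Q x" if xy: "x \<in> insert u S" "y \<in> insert u S" "x \<noteq> y" for x y
  proof -
    have Q: "?Q w \<noteq> 0" if "w \<in> S" for w using Y(2) S(1) that by blast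
    have "slope B w0 u x \<noteq> slope B w0 u y" if "x \<in> S" "y \<in> S"
      using S(2) xy(3) that by (auto simp: inj_on_def)
    then show ?thesis using xy Pu Q by (auto simp: slope_def frac_eq_eq)
  qed
  have "u \<notin> S" using Pu Y(2) S(1) by auto
  have "insert u S \<subseteq> V - span C"
  proof -
    have "insert u S \<subseteq> V" using u BV S(1) Y(1) by blast
    moreover have "w \<notin> span C" if "w \<in> insert u S" for w
      using L0[of w] Pu Y(2)[of w] S(1) that by auto
    ultimately show ?thesis by blast
  qed
  moreover have "pairwise (\<lambda>x y. y \<notin> span (insert x (span C))) (insert u S)"
    unfolding pairwise_def
    using not_in_span_insert_if_det[OF linear_representation[OF B] linear_representation[OF B] L0 det]
    by blast
  moreover have "dim (span C) + 2 = DIM('a)"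
  proof -
    have "independent C" using B(1) by (rule independent_mono) (auto simp: C_def)
    moreover have "card C + 2 = card B"
    proof -
      have "B = insert u (insert w0 C)" "u \<notin> insert w0 C" "w0 \<notin> C" "finite C"
        using u w0 card_B(2) by (auto simp: C_def)
      then show ?thesis by simp
    qed
    ultimately show ?thesis using card_B(1) by (simp add: dim_eq_card_independent)
  qed
  moreover have "flat V (span C)" using BV by (intro flat_span) (auto simp: C_def)
  ultimately have "card (insert u S) \<le> 3" using short unfolding belts_short_def by blast
  moreover have "finite S" using finite_subset[OF subset_trans[OF S(1) Y(1)] fin] .
  ultimately have "card S \<le> 2" using \<open>u \<notin> S\<close> by simp
  then show ?thesis using card_image[OF S(2)] S(3) by simp
qed

lemma slope_class_hyperplane:
  assumes u: "u \<in> B" "u \<noteq> w0" and w1: "w1 \<in> V" "representation B w1 w0 \<noteq> 0"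
  shows "adjacent V (span (B - {w0})) (span (insert w1 (B - {u, w0})))"
    and "representation B w w0 \<noteq> 0 \<Longrightarrow> slope B w0 u w = slope B w0 u w1 \<Longrightarrow>
      w \<in> span (insert w1 (B - {u, w0}))"
proof -
  define C where "C = B - {u, w0}"
  have C: "independent C" "independent (B - {w0})"
    unfolding C_def by (rule independent_mono[OF B(1)], blast)+
  have card1: "card (B - {w0}) + 1 = DIM('a)"
    using w0 card_B by (metis Suc_eq_plus1 card_Suc_Diff1)
  have "B - {w0} = insert u C" "u \<notin> C" "finite C" using u card_B by (auto simp: C_def)
  then have card2: "card C + 2 = DIM('a)" using card1 by simp
  have "w1 \<notin> span C"
    using in_span_iff_representation[OF B, of C w1] w0 w1(2) by (auto simp: C_def)
  then have ind: "independent (insert w1 C)" "w1 \<notin> C"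
    using independent_insertI[OF _ C(1)] span_base[of w1 C] by blast+
  have "hyperflat V (span (B - {w0}))"
    using BV C(2) card1 by (auto simp: hyperflat_def dim_eq_card_independent intro: flat_span)
  moreover have "hyperflat V (span (insert w1 C))"
    using BV ind card2 \<open>finite C\<close> w1(1)
    by (auto simp: hyperflat_def dim_eq_card_independent C_def intro!: flat_span)
  moreover have "flat V (span C)" using BV by (intro flat_span) (auto simp: C_def)
  moreover have "dim (span C) + 2 = DIM('a)" using C(1) card2 by (simp add: dim_eq_card_independent)
  moreover have "span C \<subseteq> span (B - {w0})" "span C \<subseteq> span (insert w1 C)"
    by (auto simp: C_def intro!: span_mono)
  ultimately show "adjacent V (span (B - {w0})) (span (insert w1 (B - {u, w0})))"
    unfolding adjacent_def C_def[symmetric] by blast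
  assume w: "representation B w w0 \<noteq> 0" "slope B w0 u w = slope B w0 u w1"
  define k where "k = representation B w w0 / representation B w1 w0"
  have lin: "linear (\<lambda>x. representation B x b)" for b by (rule linear_representation[OF B])
  have "w - k *\<^sub>R w1 \<in> span C"
  proof (subst in_span_iff_representation[OF B])
    show "C \<subseteq> B" by (auto simp: C_def)
    have "representation B (w - k *\<^sub>R w1) b = representation B w b - k * representation B w1 b" for b
      using linear_diff[OF lin] linear_scale[OF lin] by simp
    moreover have "representation B w u = k * representation B w1 u"
      using w w1(2) by (simp add: slope_def k_def frac_eq_eq field_simps)
    ultimately show "\<forall>b\<in>B - C. representation B (w - k *\<^sub>R w1) b = 0"
      using w1(2) by (auto simp: C_def k_def)
  qed
  then show "w \<in> span (insert w1 (B - {u, w0}))"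
    unfolding C_def[symmetric] by (auto simp: span_breakdown_eq)
qed

text \<open>After rescaling and modulo the basis vectors other than \<open>a\<close>, \<open>b\<close>, \<open>c\<close>, \<open>w0\<close> the hypotheses read
  \<open>x = w0 + b + c\<close>, \<open>y = w0 + a + c\<close>, \<open>z = w0 + a + b\<close>. Factoring out \<open>w0\<close> and \<open>x\<close> as well identifies
  \<open>c\<close> with \<open>- b\<close>, so that \<open>a\<close>, \<open>b\<close>, \<open>y = a - b\<close>, \<open>z = a + b\<close> are four different directions in a plane.\<close>

lemma no_fano_pattern:
  assumes abc: "a \<in> B" "b \<in> B" "c \<in> B" "a \<noteq> b" "a \<noteq> c" "b \<noteq> c" "w0 \<notin> {a, b, c}"
    and xyz: "{x, y, z} \<subseteq> V" "\<And>w. w \<in> {x, y, z} \<Longrightarrow> representation B w w0 \<noteq> 0"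
    and sa: "slope B w0 a x = 0" "slope B w0 a y = slope B w0 a z" "slope B w0 a z \<noteq> 0"
    and sb: "slope B w0 b y = 0" "slope B w0 b x = slope B w0 b z" "slope B w0 b z \<noteq> 0"
    and sc: "slope B w0 c z = 0" "slope B w0 c x = slope B w0 c y" "slope B w0 c y \<noteq> 0"
  shows False
proof -
  \<comment> \<open>Coordinates \<open>P\<close>, \<open>Q\<close> on the plane that is left; \<open>Q\<close> is chosen to vanish at \<open>x\<close>.\<close>
  define \<beta> \<gamma> where "\<beta> = slope B w0 b z" and "\<gamma> = slope B w0 c y"
  define P where "P w = representation B w a" for w
  define Q where "Q w = \<gamma> * representation B w b - \<beta> * representation B w c" for w
  have lin: "linear (\<lambda>x. representation B x b)" for b by (rule linear_representation[OF B])
  have linP: "linear P" using lin by (simp add: P_def[abs_def])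
  have linQ: "linear Q"
    unfolding Q_def[abs_def]
    by (intro linear_compose_sub linear_compose[OF lin, unfolded o_def] linear_times) 
  have rep: "representation B w u = slope B w0 u w * representation B w w0" if "w \<in> {x, y, z}" for u w
    using xyz(2)[OF that] by (simp add: slope_def)
  define C where "C = B - {a, b, c}"
  define L where "L = span (insert x C)"
  define h where "h w = representation B w w0" for w
  define \<alpha> where "\<alpha> = slope B w0 a z"
  have nz: "h y \<noteq> 0" "h z \<noteq> 0" "\<alpha> \<noteq> 0" "\<beta> \<noteq> 0" "\<gamma> \<noteq> 0"
    using xyz(2) sa sb sc by (simp_all add: h_def \<alpha>_def \<beta>_def \<gamma>_def)
  have vals: "P x = 0" "P y = \<alpha> * h y" "P z = \<alpha> * h z"
    "Q x = 0" "Q y = - (\<beta> * \<gamma> * h y)" "Q z = \<beta> * \<gamma> * h z"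
    using sa sb sc unfolding P_def Q_def
    by (simp_all add: rep[of _ a] rep[of _ b] rep[of _ c] h_def[symmetric] \<alpha>_def \<beta>_def \<gamma>_def)
  have Pxyz: "P x = 0" "P y \<noteq> 0" "P z \<noteq> 0" using vals nz by simp_all
  have Qxyz: "Q x = 0" "Q y \<noteq> 0" "Q z \<noteq> 0" using vals nz by simp_all
  have yz: "P y * Q z \<noteq> P z * Q y"
  proof -
    have "P y * Q z - P z * Q y = 2 * (\<alpha> * h y) * (\<beta> * \<gamma> * h z)"
      by (simp add: vals)
    then show ?thesis using nz by auto
  qed
  have Qab: "P a = 1" "Q a = 0" "P b = 0" "Q b \<noteq> 0"
    using abc sc B(1) by (auto simp: P_def Q_def representation_basis \<gamma>_def)
  have L0: "P w = 0 \<and> Q w = 0" if "w \<in> L" for w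
  proof -
    have 0: "P w = 0" "Q w = 0" if "w \<in> insert x C" for w
      using that Pxyz Qxyz abc B(1) by (auto simp: P_def Q_def C_def representation_basis)
    show ?thesis
      using linear_eq_0_on_span[OF linP 0(1)] linear_eq_0_on_span[OF linQ 0(2)] that
      unfolding L_def by blast
  qed
  let ?S = "{a, b, y, z}"
  have det: "P p * Q q \<noteq> P q * Q p" if pq: "p \<in> ?S" "q \<in> ?S" "p \<noteq> q" for p q
    using pq Pxyz Qxyz Qab yz by (elim insertE emptyE) simp_all
  have "?S \<subseteq> V - L"
  proof -
    have "w \<notin> L" if "w \<in> ?S" for w using L0[of w] that Pxyz Qxyz Qab by auto
    moreover have "?S \<subseteq> V" using abc BV xyz by auto
    ultimately show ?thesis by blast
  qed
  moreover have "pairwise (\<lambda>p q. q \<notin> span (insert p L)) ?S"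
    unfolding pairwise_def using not_in_span_insert_if_det[OF linP linQ L0 det] by blast
  moreover have "flat V L" unfolding L_def using BV xyz by (intro flat_span) (auto simp: C_def)
  moreover have "dim L + 2 = DIM('a)"
  proof -
    have "x \<notin> span C"
      using in_span_iff_representation[OF B, of C x] rep[of x b] xyz(2)[of x] sb abc by (auto simp: C_def)
    moreover have indC: "independent C" using B(1) by (rule independent_mono) (auto simp: C_def)
    ultimately have "independent (insert x C)" "x \<notin> C"
      using independent_insertI span_base by blast+
    moreover have "card C + 3 = DIM('a)"
    proof -
      have "B = insert a (insert b (insert c C))" "a \<notin> insert b (insert c C)" "b \<notin> insert c C" "c \<notin> C"
        "finite C" using abc card_B(2) by (auto simp: C_def)
      then show ?thesis using card_B(1) by simp
    qed
    moreover have "finite C" using card_B(2) by (simp add: C_def)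
    ultimately show ?thesis by (simp add: L_def dim_eq_card_independent)
  qed
  ultimately have "card ?S \<le> 3" using short unfolding belts_short_def by blast
  moreover have "a \<noteq> y" "a \<noteq> z" "b \<noteq> y" "b \<noteq> z" "y \<noteq> z"
    using Qxyz Qab Pxyz yz by auto
  ultimately show False using abc by simp
qed

end

text \<open>Let \<open>k\<close> be the codimension of the common flat of \<open>H1\<close> and \<open>H2\<close>, and choose bases \<open>B1\<close> of \<open>H1\<close> and
  \<open>B2\<close> of \<open>H2\<close> extending a basis of it. Dropping one \<open>u\<close> from \<open>B1\<close> leaves a flat of codimension two,
  which lies in at most two hyperplanes besides \<open>H1\<close>. One of them therefore contains at least half of the
  \<open>k - 1\<close> new members of \<open>B2\<close>, so a single step reduces \<open>k\<close> to \<open>\<lceil>k / 2\<rceil>\<close>.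

  Repeated halving alone would give the logarithm of \<open>d\<close>; the factor 4/5 comes from \<open>k = 5\<close>, where two
  steps suffice instead of three. If no choice of \<open>u\<close> puts three of the four new vectors of \<open>B2\<close> into one
  hyperplane, then each of the four choices splits them into two pairs. Linear independence forces all
  three possible splits to occur, and this is the pattern excluded by \<open>no_fano_pattern\<close>.\<close>

theorem hyperflat_chain:
  fixes V :: "'a::euclidean_space set"
  assumes fin: "finite V" and short: "belts_short V"
  shows "\<lbrakk>hyperflat V H1; hyperflat V H2; flat V W; W \<subseteq> H1 \<inter> H2; dim W + k = DIM('a);
    4 * k \<le> 5 * 2 ^ n\<rbrakk> \<Longrightarrow> \<exists>m\<le>n. (adjacent V ^^ m) H1 H2"
proof (induction n arbitrary: H1 W k)
  case 0
  have "dim H1 \<le> dim W" "dim H2 \<le> dim W" "W \<subseteq> H1" "W \<subseteq> H2"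
    using 0 by (auto simp: hyperflat_def)
  then have "W = H1" "W = H2"
    using 0 by (metis flat_subspace hyperflat_def subspace_dim_equal)+
  then show ?case by auto
next
  case (Suc n)
  note H1 = Suc.prems(1) and H2 = Suc.prems(2)
  show ?case
  proof (cases "H1 = H2")
    case True
    then show ?thesis by (intro exI[of _ 0]) auto
  next
    case False
    define M where "M = V \<inter> (H1 \<inter> H2)"
    have spanH: "span (V \<inter> H1) = H1" "span (V \<inter> H2) = H2"
      using H1 H2 by (auto simp: hyperflat_def flat_def)
    obtain BW where BW: "BW \<subseteq> M" "independent BW" "M \<subseteq> span BW"
      using maximal_independent_subset_extend[OF empty_subsetI independent_empty, of M] by metis
    then have BW12: "BW \<subseteq> V \<inter> H1" "BW \<subseteq> V \<inter> H2" by (auto simp: M_def)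
    obtain B1 where B1: "BW \<subseteq> B1" "B1 \<subseteq> V \<inter> H1" "independent B1" "V \<inter> H1 \<subseteq> span B1"
      using maximal_independent_subset_extend[OF BW12(1) BW(2)] by metis
    obtain B2 where B2: "BW \<subseteq> B2" "B2 \<subseteq> V \<inter> H2" "independent B2" "V \<inter> H2 \<subseteq> span B2"
      using maximal_independent_subset_extend[OF BW12(2) BW(2)] by metis
    have spanB: "span B1 = H1" "span B2 = H2"
      using B1 B2 spanH by (metis span_mono span_span subset_antisym)+
    have cardB: "card B1 + 1 = DIM('a)" "card B2 + 1 = DIM('a)"
      using dim_span_eq_card_independent[OF B1(3)] dim_span_eq_card_independent[OF B2(3)] H1 H2
      unfolding spanB hyperflat_def by simp_all
    have finB: "finite B1" "finite B2" "finite BW"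
      using B1(3) B2(3) BW(2) by (simp_all add: finiteI_independent)
    have "dim W \<le> card BW"
    proof -
      have "W = span (V \<inter> W)" using Suc.prems(3) by (simp add: flat_def)
      also have "\<dots> \<subseteq> span BW"
        using Suc.prems(4) BW(3) by (intro span_minimal) (auto simp: M_def)
      finally show ?thesis by (metis BW(2) dim_span_eq_card_independent dim_subset)
    qed
    then obtain k0 where k0: "card BW + k0 = DIM('a)" "4 * k0 \<le> 5 * 2 ^ Suc n"
      using Suc.prems(5,6) card_mono[OF finB(1) B1(1)] cardB(1)
      by (intro that[of "DIM('a) - card BW"]) auto
    \<comment> \<open>\<open>k0\<close> is the codimension of the largest common flat, which \<open>BW\<close> spans.\<close>
    define U where "U = B1 - BW"
    define Y where "Y = B2 - BW"
    have finUY: "finite U" "finite Y" using finB by (auto simp: U_def Y_def)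
    have cardUY: "card U + 1 = k0" "card Y + 1 = k0"
      using cardB k0(1) B1(1) B2(1) finB card_mono[OF finB(1) B1(1)] card_mono[OF finB(2) B2(1)]
      by (simp_all add: U_def Y_def card_Diff_subset)
    have YV: "Y \<subseteq> V" and UV: "U \<subseteq> V" using B1(2) B2(2) by (auto simp: U_def Y_def)
    have Y_H1: "w \<notin> H1" if w: "w \<in> Y" for w
    proof
      assume "w \<in> H1"
      then have "w \<in> M" using w B2(2) by (auto simp: M_def Y_def)
      then have "w \<in> span (B2 - {w})"
        using BW(3) span_mono[of BW "B2 - {w}"] B2(1) w by (auto simp: Y_def)
      then show False using B2(3) w unfolding dependent_def Y_def by blast
    qed
    have "Y \<noteq> {}"
    proof
      assume "Y = {}"
      then have "card U = 0" using cardUY by simp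
      then have "U = {}" using finUY by simp
      with \<open>Y = {}\<close> have "B1 = B2" using B1(1) B2(1) by (auto simp: U_def Y_def)
      then show False using spanB False by simp
    qed
    then obtain w0 where w0: "w0 \<in> Y" by blast
    define B where "B = insert w0 B1"
    have w0_B1: "w0 \<notin> B1" using Y_H1[OF w0] spanB(1) span_base by blast
    have B: "independent B" "span B = UNIV" "B \<subseteq> V" "w0 \<in> B" "B - {w0} = B1"
    proof -
      show indB: "independent B"
        unfolding B_def using Y_H1[OF w0] spanB(1) B1(3) by (intro independent_insertI) auto
      have "card B = DIM('a)" using cardB(1) w0_B1 finB by (simp add: B_def)
      then show "span B = UNIV"
        using indB by (metis dim_eq_full dim_span dim_span_eq_card_independent)
      show "B \<subseteq> V" "w0 \<in> B" "B - {w0} = B1"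
        using w0_B1 B1(2) w0 YV by (auto simp: B_def)
    qed
    note ctx = fin short B(1-4)
    have rep_Y: "representation B w w0 \<noteq> 0" if "w \<in> Y" for w
    proof
      assume "representation B w w0 = 0"
      then have "w \<in> span B1"
        using in_span_iff_representation[OF B(1,2), of B1 w] by (auto simp: B_def)
      then show False using Y_H1[OF that] spanB(1) by simp
    qed
    have U: "u \<in> B" "u \<noteq> w0" if "u \<in> U" for u
      using that w0_B1 by (auto simp: U_def B_def)
    define \<kappa> where "\<kappa> = slope B w0"
    define cls where "cls u c = {w \<in> Y. \<kappa> u w = c}" for u c
    have slopes: "card (\<kappa> u ` Y) \<le> 2" if "u \<in> U" for u
      unfolding \<kappa>_def using card_slopes_le_2[OF ctx U[OF that] YV rep_Y] .
    \<comment> \<open>A large class of equal slopes gives a neighbour of \<open>H1\<close> that shares more with \<open>H2\<close>.\<close>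
    have advance: ?thesis
      if u: "u \<in> U" and ne: "cls u c \<noteq> {}" and large: "4 * (k0 - card (cls u c)) \<le> 5 * 2 ^ n" for u c
    proof -
      obtain w1 where w1: "w1 \<in> cls u c" using ne by blast
      then have w1': "w1 \<in> V" "representation B w1 w0 \<noteq> 0"
        using YV rep_Y by (auto simp: cls_def)
      define H where "H = span (insert w1 (B - {u, w0}))"
      have adj: "adjacent V H1 H"
        using slope_class_hyperplane(1)[OF ctx U[OF u] w1'] B(5) spanB(1) by (simp add: H_def)
      have "cls u c \<subseteq> H"
        using slope_class_hyperplane(2)[OF ctx U[OF u] w1'] rep_Y w1
        by (auto simp: cls_def H_def \<kappa>_def)
      moreover have "BW \<subseteq> H"
        using u B1(1) w0_B1 by (auto simp: H_def U_def B_def intro!: span_base)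
      ultimately have 1: "span (BW \<union> cls u c) \<subseteq> H"
        unfolding H_def by (intro span_minimal) auto
      have sub2: "BW \<union> cls u c \<subseteq> B2" using B2(1) by (auto simp: cls_def Y_def)
      have 2: "span (BW \<union> cls u c) \<subseteq> H2"
        using span_mono[OF sub2] spanB(2) by simp
      have "card (BW \<union> cls u c) = card BW + card (cls u c)"
        using finB finUY by (intro card_Un_disjoint) (auto simp: cls_def Y_def)
      then have dim: "dim (span (BW \<union> cls u c)) = card BW + card (cls u c)"
        using dim_span_eq_card_independent[OF independent_mono[OF B2(3) sub2]] by simp
      have "card (cls u c) \<le> k0"
        using card_mono[OF finUY(2), of "cls u c"] cardUY(2) by (auto simp: cls_def)
      then have "dim (span (BW \<union> cls u c)) + (k0 - card (cls u c)) = DIM('a)"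
        using dim k0(1) by simp
      moreover have "flat V (span (BW \<union> cls u c))"
        using BW(1) YV by (intro flat_span) (auto simp: M_def cls_def)
      moreover have "hyperflat V H" using adj by (simp add: adjacent_def)
      ultimately obtain m where m: "m \<le> n" "(adjacent V ^^ m) H H2"
        using Suc.IH[OF _ H2 _ _ _ large, of H "span (BW \<union> cls u c)"] 1 2 by blast
      have "(adjacent V ^^ Suc m) H1 H2" using adj m(2) by (rule relpowp_Suc_I2)
      with m(1) show ?thesis by (intro exI[of _ "Suc m"]) auto
    qed
    have majority: "\<exists>c. cls u c \<noteq> {} \<and> card Y \<le> 2 * card (cls u c)" if u: "u \<in> U" for u
    proof -
      have "\<exists>c\<in>\<kappa> u ` Y. card (\<kappa> u -` {c} \<inter> Y) * card (\<kappa> u ` Y) \<ge> card Y"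
        using finUY(2) w0 by (intro pigeonhole_card) auto
      then obtain c where c: "c \<in> \<kappa> u ` Y" "card (\<kappa> u -` {c} \<inter> Y) * card (\<kappa> u ` Y) \<ge> card Y" by blast
      have "\<kappa> u -` {c} \<inter> Y = cls u c" by (auto simp: cls_def)
      then have "card Y \<le> card (cls u c) * 2"
        using c(2) mult_le_mono2[OF slopes[OF u], of "card (cls u c)"] by (metis le_trans)
      moreover have "cls u c \<noteq> {}" using c(1) by (auto simp: cls_def)
      ultimately show ?thesis by (metis mult.commute)
    qed
    have "U \<noteq> {}" using cardUY w0 finUY by auto
    then obtain u0 where u0: "u0 \<in> U" by blast
    obtain c0 where c0: "cls u0 c0 \<noteq> {}" "card Y \<le> 2 * card (cls u0 c0)"
      using majority[OF u0] by blast
    have c0': "card (cls u0 c0) \<le> card Y"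
      using card_mono[OF finUY(2), of "cls u0 c0"] by (auto simp: cls_def)
    show ?thesis
    proof (cases "k0 = 5 \<and> n = 1")
      case False
      have "4 * (k0 - card (cls u0 c0)) \<le> 5 * 2 ^ n"
      proof -
        consider "n = 0" | "n = 1" "k0 \<noteq> 5" | j where "n = Suc (Suc j)"
          using False by (metis One_nat_def not0_implies_Suc)
        then show ?thesis
        proof cases
          case 1
          then show ?thesis using k0(2) c0(2) c0' cardUY(2) by simp presburger
        next
          case 2
          then show ?thesis using k0(2) c0(2) c0' cardUY(2) by simp
        next
          \<comment> \<open>Here \<open>5 * 2 ^ n\<close> is divisible by 4, so that rounding up \<open>k0 / 2\<close> does no harm.\<close>
          case 3
          then show ?thesis using k0(2) c0(2) cardUY(2) by simp
        qed
      qed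
      then show ?thesis using advance[OF u0 c0(1)] by blast
    next
      case True
      show ?thesis
      proof (rule ccontr)
        assume contra: "\<not> ?thesis"
        have small: "card (cls u c) \<le> 2" if "u \<in> U" for u c
        proof (rule ccontr)
          assume *: "\<not> card (cls u c) \<le> 2"
          then have "cls u c \<noteq> {}" by auto
          with * show False using advance[OF that, of c] True contra by auto
        qed
        have "card (Y - {w0}) = 3" using cardUY(2) True w0 finUY(2) by simp
        then obtain x y z where "Y - {w0} = {x, y, z}" and xyz: "x \<noteq> y" "x \<noteq> z" "y \<noteq> z"
          by (auto simp: card_3_iff)
        then have Y: "Y = {w0, x, y, z}" and w0_xyz: "w0 \<notin> {x, y, z}" using w0 by auto
        have \<kappa>0: "\<kappa> u w0 = 0" if "u \<in> U" for u
          using U[OF that] B(1,4) by (simp add: \<kappa>_def slope_def representation_basis)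
        have no3eq: "\<not> (\<kappa> u p = \<kappa> u q \<and> \<kappa> u q = \<kappa> u s)"
          if "u \<in> U" "{p, q, s} \<subseteq> Y" "p \<noteq> q" "p \<noteq> s" "q \<noteq> s" for u p q s
        proof
          assume "\<kappa> u p = \<kappa> u q \<and> \<kappa> u q = \<kappa> u s"
          then have "{p, q, s} \<subseteq> cls u (\<kappa> u p)" using that(2) by (auto simp: cls_def)
          moreover have "finite (cls u (\<kappa> u p))" using finUY(2) by (simp add: cls_def)
          ultimately have "card {p, q, s} \<le> card (cls u (\<kappa> u p))" by (rule card_mono[rotated])
          then show False using small[OF that(1), of "\<kappa> u p"] that(3-5) by simp
        qed
        have no3ne: "\<kappa> u p = \<kappa> u q \<or> \<kappa> u p = \<kappa> u s \<or> \<kappa> u q = \<kappa> u s"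
          if "u \<in> U" "{p, q, s} \<subseteq> Y" for u p q s
        proof (rule ccontr)
          assume ne: "\<not> ?thesis"
          have "{\<kappa> u p, \<kappa> u q, \<kappa> u s} \<subseteq> \<kappa> u ` Y" using that(2) by auto
          then have "card {\<kappa> u p, \<kappa> u q, \<kappa> u s} \<le> card (\<kappa> u ` Y)"
            using finUY(2) by (intro card_mono) auto
          then show False using slopes[OF that(1)] ne by simp
        qed
        \<comment> \<open>Two values, each taken twice on \<open>Y\<close>: exactly one of \<open>x\<close>, \<open>y\<close>, \<open>z\<close> shares the value 0 with \<open>w0\<close>.\<close>
        have pattern: "\<kappa> u p = 0 \<and> \<kappa> u q = \<kappa> u s \<and> \<kappa> u s \<noteq> 0 \<or>
            \<kappa> u q = 0 \<and> \<kappa> u p = \<kappa> u s \<and> \<kappa> u s \<noteq> 0 \<or>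
            \<kappa> u s = 0 \<and> \<kappa> u p = \<kappa> u q \<and> \<kappa> u q \<noteq> 0"
          if u: "u \<in> U" and pqs: "{p, q, s} = {x, y, z}" "p \<noteq> q" "p \<noteq> s" "q \<noteq> s" for u p q s
        proof -
          have sub: "{p, q, s} \<subseteq> Y" "{w0, p, q} \<subseteq> Y" "{w0, p, s} \<subseteq> Y" "{w0, q, s} \<subseteq> Y"
            and ne: "w0 \<noteq> p" "w0 \<noteq> q" "w0 \<noteq> s"
            using Y w0_xyz pqs(1) by auto
          show ?thesis
            using no3ne[OF u sub(2)] no3ne[OF u sub(3)] no3ne[OF u sub(4)] no3ne[OF u sub(1)]
              no3eq[OF u sub(1) pqs(2-4)] no3eq[OF u sub(2) ne(1,2) pqs(2)]
              no3eq[OF u sub(3) ne(1,3) pqs(3)] no3eq[OF u sub(4) ne(2,3) pqs(4)] \<kappa>0[OF u]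
            by metis
        qed
        \<comment> \<open>Each of the three ways to split \<open>Y\<close> into two pairs occurs: otherwise \<open>w0 + p = q + s\<close>
          up to scaling and modulo the common flat.\<close>
        have all_splits: "\<exists>u\<in>U. \<kappa> u p = 0"
          if pqs: "{p, q, s} = {x, y, z}" "p \<noteq> q" "p \<noteq> s" "q \<noteq> s" for p q s
        proof (rule ccontr)
          assume none: "\<not> ?thesis"
          have sum: "\<kappa> u p = \<kappa> u q + \<kappa> u s" if "u \<in> U" for u
            using pattern[OF that pqs] none that by auto
          define h where "h w = representation B w w0" for w
          have pqsY: "p \<in> Y" "q \<in> Y" "s \<in> Y" using Y pqs(1) by auto
          then have h: "h p \<noteq> 0" "h q \<noteq> 0" "h s \<noteq> 0" "h w0 = 1"
            using rep_Y B(1,4) by (simp_all add: h_def representation_basis)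
          define d where "d = (1 / h p) *\<^sub>R p + w0 - (1 / h q) *\<^sub>R q - (1 / h s) *\<^sub>R s"
          have lin: "linear (\<lambda>x. representation B x b)" for b by (rule linear_representation[OF B(1,2)])
          have rep_d: "representation B d b = representation B p b / h p + representation B w0 b
              - representation B q b / h q - representation B s b / h s" for b
            unfolding d_def
            by (simp add: linear_diff[OF lin] linear_add[OF lin] linear_scale[OF lin])
          have "d \<in> span BW"
          proof (subst in_span_iff_representation[OF B(1,2)])
            show "BW \<subseteq> B" using B1(1) by (auto simp: B_def)
            have "representation B d w0 = 0" unfolding rep_d using h by (simp add: h_def)
            moreover have "representation B d u = 0" if "u \<in> U" for u
              unfolding rep_d using sum[OF that] \<kappa>0[OF that] rep_Y[OF w0]
              by (simp add: \<kappa>_def slope_def h_def)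
            ultimately show "\<forall>b\<in>B - BW. representation B d b = 0" by (auto simp: B_def U_def)
          qed
          moreover have "BW \<subseteq> B2 - {p}" using pqsY B2(1) by (auto simp: Y_def)
          ultimately have "d \<in> span (B2 - {p})" using span_mono by blast
          moreover have "w0 \<in> B2 - {p}" "q \<in> B2 - {p}" "s \<in> B2 - {p}"
            using pqsY w0 pqs w0_xyz by (auto simp: Y_def)
          ultimately have "h p *\<^sub>R (d - w0 + (1 / h q) *\<^sub>R q + (1 / h s) *\<^sub>R s) \<in> span (B2 - {p})"
            by (intro span_scale span_add span_diff) (simp_all add: span_base)
          moreover have "h p *\<^sub>R (d - w0 + (1 / h q) *\<^sub>R q + (1 / h s) *\<^sub>R s) = p"
            using h by (simp add: d_def)
          ultimately show False using B2(3) pqsY(1) unfolding dependent_def Y_def by auto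
        qed
        obtain a where a: "a \<in> U" "\<kappa> a x = 0" using all_splits[of x y z] xyz by auto
        obtain b where b: "b \<in> U" "\<kappa> b y = 0" using all_splits[of y x z] xyz by (auto simp: insert_commute)
        obtain c where c: "c \<in> U" "\<kappa> c z = 0" using all_splits[of z x y] xyz by (auto simp: insert_commute)
        have a': "\<kappa> a y = \<kappa> a z" "\<kappa> a z \<noteq> 0" using pattern[OF a(1) refl xyz] a(2) by auto
        have b': "\<kappa> b x = \<kappa> b z" "\<kappa> b z \<noteq> 0" using pattern[OF b(1) refl xyz] b(2) by auto
        have c': "\<kappa> c x = \<kappa> c y" "\<kappa> c y \<noteq> 0" using pattern[OF c(1) refl xyz] c(2) by auto
        have ne: "a \<noteq> b" "a \<noteq> c" "b \<noteq> c" using a b c a' b' c' by auto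
        have "{x, y, z} \<subseteq> Y" using Y by auto
        then have "{x, y, z} \<subseteq> V" "\<And>w. w \<in> {x, y, z} \<Longrightarrow> representation B w w0 \<noteq> 0"
          using YV rep_Y by auto
        then show False
          using no_fano_pattern[OF ctx U(1)[OF a(1)] U(1)[OF b(1)] U(1)[OF c(1)] ne, of x y z]
            a(2) b(2) c(2) a' b' c' U(2)[OF a(1)] U(2)[OF b(1)] U(2)[OF c(1)]
          unfolding \<kappa>_def by auto
      qed
    qed
  qed
qed

section \<open>Facets, ridges and belts of a zonotope\<close>

text \<open>The normal of a facet determines it, and the generators orthogonal to the normal span a hyperplane
  because the facet is parallel to it and has the same dimension.\<close>

lemma facet_zono:
  assumes "finite V" "polytope (zono a V)" "aff_dim (zono a V) = int (DIM('a))" "F facet_of zono a (V :: 'a::euclidean_space set)"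
  obtains f where "f \<noteq> 0" "F = max_face f (zono a V)"
    "direction_space F = span {v \<in> V. f \<bullet> v = 0}" "hyperflat V (direction_space F)"
proof -
  obtain f b where f: "f \<noteq> 0" "zono a V \<subseteq> {x. f \<bullet> x \<le> b}" "F = zono a V \<inter> {x. f \<bullet> x = b}"
    using facet_of_polyhedron[OF polytope_imp_polyhedron[OF assms(2)] assms(4)] by metis
  have "F \<noteq> {}" using assms(4) by (simp add: facet_of_def)
  then obtain x where x: "x \<in> zono a V" "f \<bullet> x = b" using f(3) by blast
  have F: "F = max_face f (zono a V)"
    unfolding f(3) max_face_def using f(2) x by (auto intro: order_antisym)
  have dir: "direction_space F = span {v \<in> V. f \<bullet> v = 0}"
    unfolding F by (rule direction_space_max_face[OF assms(1)])
  have "int (dim (direction_space F)) = int (DIM('a)) - 1"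
    using aff_dim_direction_space[OF \<open>F \<noteq> {}\<close>] assms(3,4) by (simp add: facet_of_def)
  then have "dim (direction_space F) + 1 = DIM('a)" by linarith
  moreover have "flat V (direction_space F)" unfolding dir by (intro flat_span) auto
  ultimately show thesis using that[OF f(1) F dir] by (simp add: hyperflat_def)
qed

text \<open>The face is the one where a functional is maximal that vanishes on \<open>L\<close> but on no generator
  outside \<open>L\<close>. For \<open>L\<close> of codimension one and two it is a facet and a ridge.\<close>

lemma face_with_direction:
  assumes "finite V" "convex (zono a V)" "flat V L"
  obtains F where "F face_of zono a V" "F \<noteq> {}" "direction_space F = L" "aff_dim F = int (dim L)"
proof -
  obtain f where f: "\<And>x. x \<in> L \<Longrightarrow> f \<bullet> x = 0" "\<And>v. v \<in> V - L \<Longrightarrow> f \<bullet> v \<noteq> 0"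
    using finite_generic_orthogonal[OF assms(1) flat_subspace[OF assms(3)]] by metis
  have "{v \<in> V. f \<bullet> v = 0} = V \<inter> L" using f by auto
  then have dir: "direction_space (max_face f (zono a V)) = L"
    using assms(3) by (simp add: direction_space_max_face[OF assms(1)] flat_def)
  show thesis
    using that[OF max_face_face_of[OF assms(2)] max_face_zono_nonempty[OF assms(1)] dir]
      aff_dim_direction_space[OF max_face_zono_nonempty[OF assms(1)], of f a] dir by simp
qed

lemma max_face_scaleR_pos:
  assumes "c > 0"
  shows "max_face (c *\<^sub>R f) P = max_face f P"
  using assms by (simp add: max_face_def)

lemma zono_symmetric:
  fixes a :: "'a::euclidean_space"
  assumes "finite V"
  defines "c \<equiv> a + (1/2) *\<^sub>R (\<Sum>v\<in>V. v)"
  shows "(\<lambda>x. 2 *\<^sub>R c - x) ` zono a V = zono a V"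
proof -
  have sub: "2 *\<^sub>R c - x \<in> zono a V" if x: "x \<in> zono a V" for x
  proof -
    obtain l where l: "x = a + (\<Sum>v\<in>V. l v *\<^sub>R v)" "\<forall>v\<in>V. 0 \<le> l v \<and> l v \<le> 1"
      using x unfolding zono_eq[OF assms(1)] by blast
    have "2 *\<^sub>R c = (a + a) + (\<Sum>v\<in>V. v)"
      by (simp add: c_def scaleR_add_right scaleR_2)
    then have "2 *\<^sub>R c - x = a + (\<Sum>v\<in>V. (1 - l v) *\<^sub>R v)"
      by (simp add: l(1) scaleR_diff_left sum_subtractf)
    moreover have "\<forall>v\<in>V. 0 \<le> 1 - l v \<and> 1 - l v \<le> 1" using l(2) by simp
    ultimately show ?thesis
      unfolding zono_eq[OF assms(1)] by (intro CollectI exI[of _ "\<lambda>v. 1 - l v"] conjI)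
  qed
  show ?thesis
  proof
    show "zono a V \<subseteq> (\<lambda>x. 2 *\<^sub>R c - x) ` zono a V"
    proof
      fix x assume "x \<in> zono a V"
      then have "2 *\<^sub>R c - x \<in> zono a V" by (rule sub)
      then show "x \<in> (\<lambda>x. 2 *\<^sub>R c - x) ` zono a V" by (rule rev_image_eqI) simp
    qed
  qed (use sub in blast)
qed

lemma max_face_reflect:
  assumes "(\<lambda>x. 2 *\<^sub>R c - x) ` P = P"
  shows "max_face (- f) P = (\<lambda>x. 2 *\<^sub>R c - x) ` max_face f P"
proof -
  have P: "2 *\<^sub>R c - x \<in> P" if "x \<in> P" for x using assms that by blast
  have sub: "2 *\<^sub>R c - x \<in> max_face (- f) P" if x: "x \<in> max_face f P" for f x
  proof -
    have "(- f) \<bullet> y \<le> (- f) \<bullet> (2 *\<^sub>R c - x)" if "y \<in> P" for y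
    proof -
      have "f \<bullet> (2 *\<^sub>R c - y) \<le> f \<bullet> x" using x P[OF that] by (simp add: max_face_def)
      then show ?thesis by (simp add: inner_diff_right)
    qed
    then show ?thesis using x P by (simp add: max_face_def)
  qed
  show ?thesis
  proof
    show "max_face (- f) P \<subseteq> (\<lambda>x. 2 *\<^sub>R c - x) ` max_face f P"
    proof
      fix x assume "x \<in> max_face (- f) P"
      then have "2 *\<^sub>R c - x \<in> max_face f P" using sub[of x "- f"] by simp
      then show "x \<in> (\<lambda>x. 2 *\<^sub>R c - x) ` max_face f P" by (rule rev_image_eqI) simp
    qed
  qed (use sub in blast)
qed

text \<open>The normals of parallel facets are proportional. A positive factor gives the same facet, and a
  negative one gives its image under the central symmetry of the zonotope.\<close>

lemma parallel_facets:
  assumes "finite V" "polytope (zono a V)" "aff_dim (zono a V) = int (DIM('a))"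
    and F: "F facet_of zono a V" and G: "G facet_of zono a (V :: 'a::euclidean_space set)"
    and eq: "direction_space F = direction_space G"
  shows "F = G \<or> opposite_facets (zono a V) F G"
proof -
  obtain f where f: "f \<noteq> 0" "F = max_face f (zono a V)"
    "direction_space F = span {v \<in> V. f \<bullet> v = 0}" "hyperflat V (direction_space F)"
    using facet_zono[OF assms(1-3) F] by metis
  obtain g where g: "g \<noteq> 0" "G = max_face g (zono a V)"
    "direction_space G = span {v \<in> V. g \<bullet> v = 0}"
    using facet_zono[OF assms(1-3) G] by metis
  define H where "H = direction_space F"
  have "orthogonal f x" if "x \<in> H" for x
    by (rule orthogonal_to_span[where S = "{v \<in> V. f \<bullet> v = 0}"]) (use that f(3) in \<open>auto simp: H_def orthogonal_def\<close>)
  then have fH: "f \<bullet> x = 0" if "x \<in> H" for x using that by (simp add: orthogonal_def)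
  have "orthogonal g x" if "x \<in> H" for x
    by (rule orthogonal_to_span[where S = "{v \<in> V. g \<bullet> v = 0}"]) (use that g(3) eq in \<open>auto simp: H_def orthogonal_def\<close>)
  then have gH: "g \<bullet> x = 0" if "x \<in> H" for x using that by (simp add: orthogonal_def)
  define c where "c = (g \<bullet> f) / (f \<bullet> f)"
  have "g - c *\<^sub>R f = 0"
  proof (rule orthogonal_to_spanning_set_eq_0)
    have "f \<notin> H" using fH[of f] f(1) by auto
    moreover have "span H = H" by (simp add: H_def direction_space_def span_span)
    ultimately have "dim (insert f H) = dim H + 1" by (simp only: dim_insert if_False)
    then show "dim (span (insert f H)) = DIM('a)"
      using f(4) by (simp add: hyperflat_def H_def)
    show "(g - c *\<^sub>R f) \<bullet> x = 0" if "x \<in> insert f H" for x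
      using that fH gH f(1) by (auto simp: inner_diff_left c_def)
  qed
  then have gc: "g = c *\<^sub>R f" by simp
  then consider "c > 0" | "c < 0" using g(1) by (cases c "0::real" rule: linorder_cases) auto
  then show ?thesis
  proof cases
    case 1
    then show ?thesis using f(2) g(2) gc max_face_scaleR_pos by metis
  next
    case 2
    then have "G = max_face (- f) (zono a V)"
      using max_face_scaleR_pos[of "- c" "- f" "zono a V"] g(2) gc by simp
    then have "opposite_facets (zono a V) F G"
      unfolding opposite_facets_def
      using F G f(2) zono_symmetric[OF assms(1), of a] max_face_reflect[OF zono_symmetric[OF assms(1), of a], of f]
      by blast
    then show ?thesis ..
  qed
qed

text \<open>Every hyperplane of the chain is the direction of some facet, and every flat of codimension two
  shared by consecutive hyperplanes is the direction of a ridge, whose belt contains both facets. A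
  chain of length 0 only says that the facets are parallel; this is where the convention on opposite
  facets enters.\<close>

lemma belt_distance_le_chain:
  assumes "finite V" and poly: "polytope (zono a V)"
    and full: "aff_dim (zono a V) = int (DIM('a))"
    and F: "F facet_of zono a V" and G: "G facet_of zono a (V :: 'a::euclidean_space set)"
    and chain: "(adjacent V ^^ m) (direction_space F) (direction_space G)"
  shows "belt_distance (zono a V) F G \<le> enat m"
proof -
  define P where "P = zono a V"
  have conv: "convex P" unfolding P_def by (rule polytope_imp_convex[OF poly])
  have path: "belt_distance P F G \<le> enat n" if "belt_path P n Fs Bs" "Fs 0 = F" "Fs n = G" for n Fs Bs
    using that unfolding belt_distance_def by (auto intro!: Inf_lower)
  show ?thesis
  proof (cases "m = 0")
    case True
    then have "direction_space F = direction_space G" using chain by simp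
    then consider "F = G" | "opposite_facets P F G"
      using parallel_facets[OF assms(1-3) F G] by (auto simp: P_def)
    then show ?thesis
    proof cases
      case 1
      have "belt_path P 0 (\<lambda>_. F) (\<lambda>_. {})" using F by (simp add: belt_path_def P_def)
      then show ?thesis using path[of 0 "\<lambda>_. F"] 1 True by (simp add: P_def)
    next
      case 2
      then show ?thesis by (simp add: belt_distance_def P_def)
    qed
  next
    case False
    obtain D where D: "D 0 = direction_space F" "D m = direction_space G"
      "\<And>i. i < m \<Longrightarrow> adjacent V (D i) (D (Suc i))"
      using chain unfolding relpowp_fun_conv by blast
    have facet: "\<exists>K. K facet_of P \<and> direction_space K = H" if H: "hyperflat V H" for H
    proof -
      have "flat V H" using H by (simp add: hyperflat_def)
      then obtain K where K: "K face_of P" "K \<noteq> {}" "direction_space K = H" "aff_dim K = int (dim H)"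
        by (rule face_with_direction[OF assms(1) conv[unfolded P_def], folded P_def])
      have "int (dim H) = int (DIM('a)) - 1" using H by (simp add: hyperflat_def)
      then have "K facet_of P" using K full by (simp add: facet_of_def P_def)
      with K(3) show ?thesis by blast
    qed
    have "\<exists>K. K facet_of P \<and> direction_space K = D i \<and> (i = 0 \<longrightarrow> K = F) \<and> (i = m \<longrightarrow> K = G)"
      if i: "i \<le> m" for i
    proof -
      consider "i = 0" | "i = m" | "i \<noteq> 0" "i < m" using i by linarith
      then show ?thesis
      proof cases
        case 3
        then show ?thesis using facet[of "D i"] D(3)[of i] by (auto simp: adjacent_def)
      qed (use D F G False in \<open>auto simp: P_def\<close>)
    qed
    then obtain Fs where Fs: "\<And>i. i \<le> m \<Longrightarrow> Fs i facet_of P" "\<And>i. i \<le> m \<Longrightarrow> direction_space (Fs i) = D i"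
      "Fs 0 = F" "Fs m = G"
      by (metis le0 le_refl)
    have "\<exists>B. B \<in> belts P \<and> Fs (i - 1) \<in> B \<and> Fs i \<in> B" if i: "i \<in> {1..m}" for i
    proof -
      have "i - 1 < m" "Suc (i - 1) = i" using i by auto
      then have "adjacent V (D (i - 1)) (D i)" using D(3)[of "i - 1"] by simp
      then obtain L where L: "flat V L" "dim L + 2 = DIM('a)" "L \<subseteq> D (i - 1)" "L \<subseteq> D i"
        by (auto simp: adjacent_def)
      obtain R where R: "R face_of P" "R \<noteq> {}" "direction_space R = L" "aff_dim R = int (dim L)"
        using L(1) by (rule face_with_direction[OF assms(1) conv[unfolded P_def], folded P_def])
      have "int (dim L) = int (DIM('a)) - 2" using L(2) by linarith
      then have "R ridge_of P" using R full by (simp add: ridge_of_def P_def)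
      then have "belt P R \<in> belts P" by (auto simp: belts_def)
      moreover have "Fs (i - 1) \<in> belt P R" "Fs i \<in> belt P R"
        using Fs(1,2)[of "i - 1"] Fs(1,2)[of i] i L R(3) by (auto simp: belt_def)
      ultimately show ?thesis by blast
    qed
    then obtain Bs where "\<And>i. i \<in> {1..m} \<Longrightarrow> Bs i \<in> belts P \<and> Fs (i - 1) \<in> Bs i \<and> Fs i \<in> Bs i"
      by metis
    then have "belt_path P m Fs Bs" using Fs(1) by (simp add: belt_path_def)
    then show ?thesis using path Fs(3,4) by (simp add: P_def)
  qed
qed


theorem corollary4p6:
  fixes P :: "'a::euclidean_space set" and d :: nat
  assumes "d \<ge> 1"
    and "DIM('a) = d"
    and "space_filling_zonotope P"
  shows "ereal_of_enat (belt_diameter P) \<le> ereal (real_of_int \<lceil>log 2 (4 / 5 * real d)\<rceil>)"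
proof -
  obtain V a where V: "finite V" "P = zono a V"
    using assms(3) by (auto simp: space_filling_zonotope_def zonotope_def)
  have P: "polytope (zono a V)" "aff_dim (zono a V) = int (DIM('a))" "tiles_by_translates (zono a V)"
    using assms(3) by (simp_all add: space_filling_zonotope_def parallelohedron_def V(2))
  have conv: "convex (zono a V)" by (rule polytope_imp_convex[OF P(1)])
  have "interior (zono a V) \<noteq> {}"
    using interior_rel_interior_gen[of "zono a V"] P(2) rel_interior_eq_empty[OF conv] by auto
  then have short: "belts_short V"
    using tiling_zonotope_belts_short[OF V(1) _ polytope_imp_compact[OF P(1)] conv P(3)] by blast
  define n where "n = nat \<lceil>log 2 (4 / 5 * real d)\<rceil>"
  \<comment> \<open>The ceiling is nonnegative because the logarithm exceeds \<open>-1\<close> even for \<open>d = 1\<close>.\<close>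
  have "log 2 (1 / 2) < log 2 (4 / 5 * real d)"
    using assms(1) by (subst log_less_cancel_iff) auto
  then have "- 1 < log 2 (4 / 5 * real d)" by (simp add: log_divide)
  then have n: "real_of_int \<lceil>log 2 (4 / 5 * real d)\<rceil> = real n"
    by (simp add: n_def)
  then have "log 2 (4 / 5 * real d) \<le> real n" by linarith
  then have "4 / 5 * real d \<le> 2 powr real n"
    using assms(1) by (subst (asm) log_le_iff) auto
  then have "real (4 * d) \<le> real (5 * 2 ^ n)" by (simp add: powr_realpow)
  then have "4 * d \<le> 5 * 2 ^ n" by (simp only: of_nat_le_iff)
  have dist: "belt_distance P F G \<le> enat n" if F: "F facet_of P" and G: "G facet_of P" for F G
  proof -
    have hyper: "hyperflat V (direction_space F)" "hyperflat V (direction_space G)"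
      using facet_zono[OF V(1) P(1,2)] F G unfolding V(2) by metis+
    have "flat V {0}" using flat_span[of "{}" V] by (simp add: span_empty)
    moreover have "dim ({0} :: 'a set) + d = DIM('a)" using assms(2) by simp
    moreover have "{0} \<subseteq> direction_space F \<inter> direction_space G"
      by (auto simp: direction_space_def span_zero)
    ultimately obtain m where m: "m \<le> n" "(adjacent V ^^ m) (direction_space F) (direction_space G)"
      using hyperflat_chain[OF V(1) short hyper _ _ _ \<open>4 * d \<le> 5 * 2 ^ n\<close>] by blast
    have "belt_distance P F G \<le> enat m"
      using belt_distance_le_chain[OF V(1) P(1,2) _ _ m(2)] F G by (simp add: V(2))
    also have "enat m \<le> enat n" using m(1) by simp
    finally show ?thesis .
  qed
  have "belt_diameter P \<le> enat n"
    unfolding belt_diameter_def by (rule Sup_least) (use dist in auto)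
  then have "ereal_of_enat (belt_diameter P) \<le> ereal_of_enat (enat n)"
    by (simp only: ereal_of_enat_le_iff)
  then show ?thesis unfolding n by simp
qed

end
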